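(* Let $\Psi\colon\mathbb{R}^{d+n}\to\mathbb{R}$, $(\mathbf{x},\mathbf{y})\mapsto\Psi(\mathbf{x},\mathbf{y})$, be convex-concave (convex in $\mathbf{x}\in\mathbb{R}^d$, concave in $\mathbf{y}\in\mathbb{R}^n$) and smooth (differentiable with Lipschitz gradient), and let $h_1\colon\mathbb{R}^d\to\mathbb{R}\cup\{+\infty\}$, $h_2\colon\mathbb{R}^n\to\mathbb{R}\cup\{+\infty\}$ be convex, proper and lower semicontinuous. For $\mathbf{z}=(\mathbf{x},\mathbf{y})$ set $$F(\mathbf{z})=\begin{pmatrix}\nabla_{\mathbf{x}}\Psi(\mathbf{x},\mathbf{y})\\-\nabla_{\mathbf{y}}\Psi(\mathbf{x},\mathbf{y})\end{pmatrix},\qquad H(\mathbf{z})=\begin{pmatrix}\partial h_1(\mathbf{x})\\ \partial h_2(\mathbf{y})\end{pmatrix},\qquad h(\mathbf{z})=h_1(\mathbf{x})+h_2(\mathbf{y}),$$ and let $\mathbf{z}^\star$ be a solution of $0\in F(\mathbf{z}^\star)+H(\mathbf{z}^\star)$. Fix $\mathbf{z}_0,\mathbf{g}_0\in\mathbb{R}^{d+n}$, and assume access to an oracle $\widetilde{F}(\mathbf{z},\xi)$, $\xi\sim\Xi$, such that for all $\mathbf{z},\mathbf{z}'$ $$\mathbb{E}[\widetilde{F}(\mathbf{z},\xi)]=F(\mathbf{z}),\quad \mathbb{E}\|\widetilde{F}(\mathbf{z},\xi)-F(\mathbf{z})\|^2\le B^2\|\mathbf{z}-\mathbf{z}_0\|^2+G^2,\quad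 \mathbb{E}\|\widetilde{F}(\mathbf{z},\xi)-\widetilde{F}(\mathbf{z}',\xi)\|^2\le L^2\|\mathbf{z}-\mathbf{z}'\|^2,$$ with finite $B,L>0$, $G\ge0$. For $k\ge0$ let $$\begin{cases}\bar{\mathbf{z}}_k=\beta_k\mathbf{z}_0+(1-\beta_k)\mathbf{z}_k\\ \mathbf{z}_{k+1/2}=\mathrm{prox}_{\gamma_k h}(\bar{\mathbf{z}}_k-\gamma_k\mathbf{g}_k)\\ \mathbf{z}_{k+1}=\mathrm{prox}_{\tau_k\gamma_k h}(\bar{\mathbf{z}}_k-\tau_k\gamma_k\widetilde{F}(\mathbf{z}_{k+1/2},\xi_{k+1/2}))\\ \mathbf{g}_{k+1}=\widetilde{F}(\mathbf{z}_{k+1},\xi_{k+1})+(1-\alpha_k)(\mathbf{g}_k-\widetilde{F}(\mathbf{z}_k,\xi_{k+1}))\end{cases}$$ where $\xi_{1/2},\xi_1,\xi_{3/2},\xi_2,\dots$ are i.i.d. with law $\Xi$, with parameters $$\beta_k=\frac{1}{k+3},\quad \alpha_k=\frac{2}{\sqrt{k+3}},\quad \gamma_k=\frac{1-\beta_k}{6L},\quad \tau_k=\frac{\tau}{\sqrt{k+3}},\quad \tau:=\min\left(\frac14,\frac{L^2}{12B^2}\right).$$ Then for every $K\ge2$, $$\frac{1}{\sum_{i=0}^{K-1}\sqrt{i+3}}\sum_{k=0}^{K-1}\sqrt{k+3}\;\mathbb{E}\big[\mathrm{dist}^2(0,(F+H)\mathbf{z}_{k+1/2})\big]$$ $$\le\frac{1221}{\big((K+2)^{3/2}-3^{3/2}\big)\tau}\Big((K+2)L^2\|\mathbf{z}_0-\mathbf{z}^\star\|^2+\tau\|\mathbf{g}_0-F(\mathbf{z}_0)\|^2+K(\tau+2)^2G^2\Big)=O\left(\frac{1}{\sqrt{K}}\right).$$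 Equivalently, if $\hat k\in\{0,\dots,K-1\}$ is selected at random (independently of the algorithm) with $\Pr(\hat k=k)=\frac{\sqrt{k+3}}{\sum_{i=0}^{K-1}\sqrt{i+3}}$, then for $\varepsilon>0$ one has $\mathbb{E}[\mathrm{dist}^2(0,(F+H)\mathbf{z}_{\hat k+1/2})]\le\varepsilon^2$ with stochastic first-order oracle complexity (number of evaluations of $\widetilde{F}$) $O(\varepsilon^{-4})$.
   Context: $\|\cdot\|$ is the Euclidean norm; $\mathrm{prox}_{h}(\mathbf{x})=\arg\min_{\mathbf{y}}\{h(\mathbf{y})+\frac12\|\mathbf{y}-\mathbf{x}\|^2\}$; $\mathrm{dist}(\mathbf{x},S)=\inf_{\mathbf{y}\in S}\|\mathbf{x}-\mathbf{y}\|$; $(F+H)\mathbf{z}=\{F(\mathbf{z})+\mathbf{u}:\mathbf{u}\in H(\mathbf{z})\}$. The inclusion $0\in F(\mathbf{z})+H(\mathbf{z})$ encodes the optimality conditions of $\min_{\mathbf{x}}\max_{\mathbf{y}}\Psi(\mathbf{x},\mathbf{y})+h_1(\mathbf{x})-h_2(\mathbf{y})$. The $O(\cdot)$ constants do not depend on $K$ or $\varepsilon$ (they depend on $L,B,G,\mathbf{z}_0,\mathbf{z}^\star,\mathbf{g}_0$). *)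

theory Defs
  imports "HOL-Probability.Probability" "HOL-Library.Landau_Symbols"
begin

section \<open>Convex analysis\<close>

definition proper_fun :: "('v \<Rightarrow> ereal) \<Rightarrow> bool" where
  "proper_fun h \<longleftrightarrow> (\<forall>x. h x \<noteq> -\<infinity>) \<and> (\<exists>x. h x \<noteq> \<infinity>)"

text \<open>Only used for functions that never take the value \<open>-\<infinity>\<close>, so that no sum \<open>\<infinity> + (-\<infinity>)\<close>
  arises; \<open>0 * \<infinity> = 0\<close> makes the cases \<open>u = 0\<close> and \<open>v = 0\<close> trivial.\<close>

definition ereal_convex :: "('v::real_vector \<Rightarrow> ereal) \<Rightarrow> bool" where
  "ereal_convex h \<longleftrightarrow>
     (\<forall>x y. \<forall>u\<ge>0. \<forall>v\<ge>0. u + v = 1 \<longrightarrow>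
        h (u *\<^sub>R x + v *\<^sub>R y) \<le> ereal u * h x + ereal v * h y)"

definition lower_semicont :: "('v::topological_space \<Rightarrow> ereal) \<Rightarrow> bool" where
  "lower_semicont h \<longleftrightarrow> (\<forall>x. h x \<le> Liminf (at x) h)"

definition subdifferential :: "('v::real_inner \<Rightarrow> ereal) \<Rightarrow> 'v \<Rightarrow> 'v set" where
  "subdifferential h x = {g. \<forall>y. h x + ereal (g \<bullet> (y - x)) \<le> h y}"

definition prox :: "('v::real_normed_vector \<Rightarrow> ereal) \<Rightarrow> 'v \<Rightarrow> 'v" where
  "prox h x = (ARG_MIN (\<lambda>y. h y + ereal (1 / 2 * (norm (y - x))\<^sup>2)) y. True)"

text \<open>Extended-valued, so that the distance to the empty set is \<open>\<infinity>\<close> (\<open>infdist\<close> gives 0 there).\<close>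

definition dist_set :: "'v::real_normed_vector \<Rightarrow> 'v set \<Rightarrow> ennreal" where
  "dist_set x S = (INF y\<in>S. ennreal (norm (x - y)))"

definition gradient :: "('v::real_inner \<Rightarrow> real) \<Rightarrow> 'v \<Rightarrow> 'v" where
  "gradient f x = (THE D. GDERIV f x :> D)"


section \<open>The saddle-point inclusion\<close>

definition saddle_F ::
    "('a::real_inner \<times> 'b::real_inner \<Rightarrow> real) \<Rightarrow> 'a \<times> 'b \<Rightarrow> 'a \<times> 'b" where
  "saddle_F \<Psi> z =
     (gradient (\<lambda>x. \<Psi> (x, snd z)) (fst z), - gradient (\<lambda>y. \<Psi> (fst z, y)) (snd z))"

definition saddle_H ::
    "('a::real_inner \<Rightarrow> ereal) \<Rightarrow> ('b::real_inner \<Rightarrow> ereal) \<Rightarrow> 'a \<times> 'b \<Rightarrow> ('a \<times> 'b) set" where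
  "saddle_H h1 h2 z = subdifferential h1 (fst z) \<times> subdifferential h2 (snd z)"

definition sep_sum :: "('a \<Rightarrow> ereal) \<Rightarrow> ('b \<Rightarrow> ereal) \<Rightarrow> 'a \<times> 'b \<Rightarrow> ereal" where
  "sep_sum h1 h2 z = h1 (fst z) + h2 (snd z)"

definition op_sum :: "('v::plus \<Rightarrow> 'v) \<Rightarrow> ('v \<Rightarrow> 'v set) \<Rightarrow> 'v \<Rightarrow> 'v set" where
  "op_sum F H z = {F z + u | u. u \<in> H z}"


section \<open>The algorithm\<close>

definition beta_par :: "nat \<Rightarrow> real" where
  "beta_par k = 1 / (real k + 3)"

definition alpha_par :: "nat \<Rightarrow> real" where
  "alpha_par k = 2 / sqrt (real k + 3)"

definition gamma_par :: "real \<Rightarrow> nat \<Rightarrow> real" where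
  "gamma_par L k = (1 - beta_par k) / (6 * L)"

definition tau_const :: "real \<Rightarrow> real \<Rightarrow> real" where
  "tau_const L B = min (1 / 4) (L\<^sup>2 / (12 * B\<^sup>2))"

definition tau_par :: "real \<Rightarrow> real \<Rightarrow> nat \<Rightarrow> real" where
  "tau_par L B k = tau_const L B / sqrt (real k + 3)"

definition z_bar :: "'v::real_vector \<Rightarrow> nat \<Rightarrow> 'v \<Rightarrow> 'v" where
  "z_bar z0 k z = beta_par k *\<^sub>R z0 + (1 - beta_par k) *\<^sub>R z"

definition half_step ::
    "('v::real_normed_vector \<Rightarrow> ereal) \<Rightarrow> real \<Rightarrow> 'v \<Rightarrow> nat \<Rightarrow> 'v \<Rightarrow> 'v \<Rightarrow> 'v" where
  "half_step h L z0 k z g =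
     prox (\<lambda>w. ereal (gamma_par L k) * h w) (z_bar z0 k z - gamma_par L k *\<^sub>R g)"

text \<open>Every evaluation of the stochastic oracle goes through \<open>query\<close>, which advances a counter.\<close>

definition query :: "('v \<Rightarrow> 's \<Rightarrow> 'v) \<Rightarrow> 'v \<Rightarrow> 's \<Rightarrow> nat \<Rightarrow> 'v \<times> nat" where
  "query Ft z s c = (Ft z s, Suc c)"

text \<open>\<open>run h Ft L B z0 g0 s k\<close> is \<open>(z\<^sub>k, g\<^sub>k, c\<^sub>k)\<close>, where \<open>c\<^sub>k\<close> counts the oracle evaluations made in
  the first \<open>k\<close> iterations. The samples have half-integer indices: \<open>s j\<close> stands for
  \<open>\<xi>\<close> with index \<open>j / 2\<close>, for \<open>j \<ge> 1\<close>.\<close>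

primrec run ::
    "('v::real_normed_vector \<Rightarrow> ereal) \<Rightarrow> ('v \<Rightarrow> 's \<Rightarrow> 'v) \<Rightarrow> real \<Rightarrow> real \<Rightarrow> 'v \<Rightarrow> 'v \<Rightarrow>
     (nat \<Rightarrow> 's) \<Rightarrow> nat \<Rightarrow> 'v \<times> 'v \<times> nat" where
  "run h Ft L B z0 g0 s 0 = (z0, g0, 0)"
| "run h Ft L B z0 g0 s (Suc k) =
     (let (z, g, c) = run h Ft L B z0 g0 s k;
          zh = half_step h L z0 k z g;
          (u, c1) = query Ft zh (s (2 * k + 1)) c;
          z' = prox (\<lambda>w. ereal (tau_par L B k * gamma_par L k) * h w)
                 (z_bar z0 k z - (tau_par L B k * gamma_par L k) *\<^sub>R u);
          (v, c2) = query Ft z' (s (2 * k + 2)) c1;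
          (w, c3) = query Ft z (s (2 * k + 2)) c2;
          g' = v + (1 - alpha_par k) *\<^sub>R (g - w)
      in (z', g', c3))"

definition z_half ::
    "('v::real_normed_vector \<Rightarrow> ereal) \<Rightarrow> ('v \<Rightarrow> 's \<Rightarrow> 'v) \<Rightarrow> real \<Rightarrow> real \<Rightarrow> 'v \<Rightarrow> 'v \<Rightarrow>
     (nat \<Rightarrow> 's) \<Rightarrow> nat \<Rightarrow> 'v" where
  "z_half h Ft L B z0 g0 s k = (let (z, g, c) = run h Ft L B z0 g0 s k in half_step h L z0 k z g)"

definition oracle_calls ::
    "('v::real_normed_vector \<Rightarrow> ereal) \<Rightarrow> ('v \<Rightarrow> 's \<Rightarrow> 'v) \<Rightarrow> real \<Rightarrow> real \<Rightarrow> 'v \<Rightarrow> 'v \<Rightarrow>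
     (nat \<Rightarrow> 's) \<Rightarrow> nat \<Rightarrow> nat" where
  "oracle_calls h Ft L B z0 g0 s K = snd (snd (run h Ft L B z0 g0 s K))"


section \<open>Averaged residual and rate\<close>

definition weight_sum :: "nat \<Rightarrow> real" where
  "weight_sum K = (\<Sum>i<K. sqrt (real i + 3))"

definition weighted_avg :: "(nat \<Rightarrow> ennreal) \<Rightarrow> nat \<Rightarrow> ennreal" where
  "weighted_avg e K = (\<Sum>k<K. ennreal (sqrt (real k + 3)) * e k) / ennreal (weight_sum K)"

text \<open>A random index in \<open>{0..<K}\<close> with weights proportional to \<open>sqrt (k + 3)\<close>, independent of the whole
  sample sequence.\<close>

definition random_index ::
    "'w measure \<Rightarrow> 's measure \<Rightarrow> (nat \<Rightarrow> 'w \<Rightarrow> 's) \<Rightarrow> nat \<Rightarrow> ('w \<Rightarrow> nat) \<Rightarrow> bool" where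
  "random_index M \<Xi> \<xi> K kh \<longleftrightarrow>
     prob_space.indep_set M
       (sets (vimage_algebra (space M) kh (count_space UNIV)))
       (sets (vimage_algebra (space M) (\<lambda>\<omega>. \<lambda>j\<in>{1..}. \<xi> j \<omega>) (\<Pi>\<^sub>M j\<in>{1..}. \<Xi>))) \<and>
     (\<forall>\<omega>\<in>space M. kh \<omega> < K) \<and>
     (\<forall>k<K. measure M {\<omega>\<in>space M. kh \<omega> = k} = sqrt (real k + 3) / weight_sum K)"

definition rate_bound :: "real \<Rightarrow> real \<Rightarrow> real \<Rightarrow> real \<Rightarrow> real \<Rightarrow> nat \<Rightarrow> real" where
  "rate_bound L B G D V K =
     1221 / (((real K + 2) powr (3 / 2) - 3 powr (3 / 2)) * tau_const L B) *
     ((real K + 2) * L\<^sup>2 * D\<^sup>2 + tau_const L B * V\<^sup>2 + real K * (tau_const L B + 2)\<^sup>2 * G\<^sup>2)"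

end

theory Submission
  imports Defs "HOL-Real_Asymp.Real_Asymp"
begin

text \<open>
  The saddle operator is monotone (\<open>saddle_F_monotone\<close>), and \<open>H\<close> is the subdifferential of the separable
  convex function \<open>h\<close> (\<open>saddle_H_eq_subdifferential\<close>). The rate then holds for every inclusion
  \<open>0 \<in> F z + \<partial>h z\<close> with such data (locale \<open>stochastic_inclusion\<close>), where \<open>F\<close> inherits the Lipschitz constant
  \<open>L\<close> from its oracle.

  The proof follows the energy
  \<open>L\<^sup>2 * (k + 2) * |z\<^sub>k - z\<^sup>\<star>|\<^sup>2 + \<tau> / 8 * (k + 2) * |g\<^sub>k - F z\<^sub>k|\<^sup>2\<close>.
  Write \<open>n = k + 3\<close> and let \<open>zb\<close> be the anchored point and \<open>w\<close> the result of the half step. Three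
  subgradient inequalities and monotonicity bound the distance from the new iterate to the solution by
  that from \<open>zb\<close>, minus multiples of the squared lengths of the two proximal steps, plus noise
  (\<open>two_step_prox_inequality\<close>). Anchoring with weight \<open>1 / n\<close> gives
  \<open>n * |zb - z\<^sup>\<star>|\<^sup>2 = (n - 1) * |z\<^sub>k - z\<^sup>\<star>|\<^sup>2 + |z\<^sub>0 - z\<^sup>\<star>|\<^sup>2 - (n - 1) / n * |z\<^sub>k - z\<^sub>0|\<^sup>2\<close>,
  so that the weighted distances telescope at the price of one \<open>|z\<^sub>0 - z\<^sup>\<star>|\<^sup>2\<close> per iteration, and the
  negative term pays for the part of the variance that grows with the distance to \<open>z\<^sub>0\<close>. With
  the step length \<open>\<eta> = \<tau> * \<gamma> / sqrt n\<close> the squared noise enters with the bounded factor \<open>n * \<eta>\<^sup>2\<close>.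

  The error of the estimator \<open>g\<close> is multiplied by \<open>1 - 2 / sqrt n\<close> in each update and receives centred noise
  (\<open>estimator_noise\<close>). With weights proportional to \<open>n\<close> its square therefore loses a multiple of
  \<open>sqrt n\<close> times itself, which pays for the use of \<open>g\<close> instead of \<open>F\<close> in the half step. What is left over is a multiple of
  \<open>sqrt n * (L\<^sup>2 * |w - zb|\<^sup>2 + |g\<^sub>k - F z\<^sub>k|\<^sup>2)\<close>. Together with a small part of the anchoring term it
  dominates \<open>sqrt n\<close> times the squared residual at \<open>w\<close> (\<open>residual_half_step_le\<close>,
  \<open>step_size_budget\<close>). Summation over \<open>k < K\<close> gives a bound linear in \<open>K\<close> for the weighted sum of
  the residuals (\<open>sum_expected_residual\<close>), whose total weight is of order \<open>K powr (3 / 2)\<close>.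

  Expectations are taken without conditional expectation. The one-step inequality holds for every fixed
  past after integration over the two new samples (\<open>energy_decrease\<close>), and by Fubini it may then be
  integrated against the product law of the earlier samples. All integrands are non-negative. The iterates
  are measurable because proximal operators are non-expansive, and the residual is measurable because its
  sublevel sets are closed (\<open>closed_residual_sublevel\<close>).
\<close>

section \<open>Lower semicontinuity\<close>

lemma lower_semicont_iff:
  "lower_semicont h \<longleftrightarrow> (\<forall>x c. c < h x \<longrightarrow> (\<forall>\<^sub>F y in nhds x. c < h y))"
  unfolding lower_semicont_def le_Liminf_iff eventually_nhds_conv_at by blast

lemma lower_semicont_seq_le:
  fixes h :: "'v::topological_space \<Rightarrow> ereal"
  assumes "lower_semicont h" "X \<longlonglongrightarrow> x" "t \<longlonglongrightarrow> T" "\<And>n. h (X n) \<le> t n"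
  shows "h x \<le> T"
proof (rule ccontr)
  assume "\<not> h x \<le> T"
  then obtain c where c: "T < c" "c < h x" using dense[of T "h x"] by (auto simp: not_le)
  have "\<forall>\<^sub>F n in sequentially. c < h (X n)"
    using assms(1,2) c(2) unfolding lower_semicont_iff filterlim_def le_filter_def eventually_filtermap
    by blast
  moreover have "\<forall>\<^sub>F n in sequentially. t n < c" using assms(3) c(1) by (rule order_tendstoD)
  ultimately have "\<forall>\<^sub>F n in sequentially. False"
    by eventually_elim (meson assms(4) leD order_less_trans)
  then show False by simp
qed

lemma lower_semicont_attains_inf:
  fixes h :: "'v::metric_space \<Rightarrow> ereal"
  assumes "lower_semicont h" "compact K" "K \<noteq> {}"
  shows "\<exists>x\<in>K. \<forall>y\<in>K. h x \<le> h y"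
proof -
  obtain u where u: "\<And>n. u n \<in> h ` K" "u \<longlonglongrightarrow> Inf (h ` K)"
    using Inf_as_limit[of "h ` K"] assms(3) by auto
  from u(1) have "\<forall>n. \<exists>x\<in>K. h x = u n" by (metis imageE)
  then obtain X where X: "\<And>n. X n \<in> K" "\<And>n. h (X n) = u n" by metis
  obtain x r where x: "x \<in> K" "strict_mono r" "(X \<circ> r) \<longlonglongrightarrow> x"
    using assms(2) X(1) unfolding compact_def by metis
  have "h x \<le> Inf (h ` K)"
    using lower_semicont_seq_le[OF assms(1) x(3) LIMSEQ_subseq_LIMSEQ[OF u(2) x(2)]] X(2) by simp
  then show ?thesis using x(1) by (meson INF_lower order_trans)
qed

lemma continuous_on_UNIV_tendsto_nhds:
  assumes "continuous_on UNIV f"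
  shows "(f \<longlongrightarrow> f x) (nhds x)"
proof -
  have "(f \<longlongrightarrow> f x) (at x)" using assms by (simp add: continuous_on_def)
  then show ?thesis by (simp add: tendsto_at_iff_tendsto_nhds)
qed

lemma lower_semicont_compose:
  assumes "lower_semicont h" "continuous_on UNIV f"
  shows "lower_semicont (\<lambda>x. h (f x))"
  unfolding lower_semicont_iff
proof (intro allI impI)
  fix x c assume "c < h (f x)"
  then have "\<forall>\<^sub>F y in nhds (f x). c < h y" using assms(1) unfolding lower_semicont_iff by blast
  moreover have "filterlim f (nhds (f x)) (nhds x)"
    using assms(2) by (rule continuous_on_UNIV_tendsto_nhds)
  ultimately show "\<forall>\<^sub>F y in nhds x. c < h (f y)"
    unfolding filterlim_iff by blast
qed

lemma lower_semicont_add: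
  assumes f: "lower_semicont f" and g: "lower_semicont g"
    and fin: "\<And>x. f x \<noteq> -\<infinity>" "\<And>x. g x \<noteq> -\<infinity>"
  shows "lower_semicont (\<lambda>x. f x + g x)"
  unfolding lower_semicont_iff
proof (intro allI impI)
  fix x c assume c: "c < f x + g x"
  obtain a b where ab: "a < f x" "b < g x" "c \<le> a + b"
  proof (cases "c = -\<infinity>")
    case True
    then show ?thesis
      using that[of "-\<infinity>" "-\<infinity>"] fin by auto
  next
    case c_not: False
    obtain r where r: "c = ereal r" using c c_not by (cases c) auto
    have real_below: "\<exists>a. ereal a < y" if "y \<noteq> -\<infinity>" for y :: ereal
      using that by (metis MInfty_neq_ereal(1) ereal_dense2 ereal_infty_less(2) order_less_le)
    show ?thesis
    proof (cases "f x")
      case (real p)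
      show ?thesis
      proof (cases "g x")
        case (real q)
        define e where "e = (p + q - r) / 2"
        have "e > 0" using c r \<open>f x = ereal p\<close> real by (simp add: e_def)
        then show ?thesis using that[of "ereal (p - e)" "ereal (q - e)"] r \<open>f x = ereal p\<close> real
          by (simp add: e_def field_simps)
      next
        case PInf
        then show ?thesis using that[of "ereal (p - 1)" "ereal (r - p + 1)"] r real by simp
      qed (use fin in auto)
    next
      case PInf
      obtain b where "ereal b < g x" using real_below fin by blast
      then show ?thesis using that[of "ereal (r - b)" "ereal b"] r PInf by simp
    qed (use fin in auto)
  qed
  have "\<forall>\<^sub>F y in nhds x. a < f y" "\<forall>\<^sub>F y in nhds x. b < g y"
    using f g ab unfolding lower_semicont_iff by blast+
  then show "\<forall>\<^sub>F y in nhds x. c < f y + g y"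
  proof eventually_elim
    case (elim y)
    then have "a + b < f y + g y" using ab
      by (metis ereal_add_strict_mono2)
    then show ?case using ab(3) by simp
  qed
qed

lemma lower_semicont_continuous:
  assumes "continuous_on UNIV f"
  shows "lower_semicont (\<lambda>x. ereal (f x))"
  unfolding lower_semicont_iff
proof (intro allI impI)
  fix x c assume c: "c < ereal (f x)"
  have "(f \<longlongrightarrow> f x) (nhds x)" using assms by (rule continuous_on_UNIV_tendsto_nhds)
  then have "((\<lambda>x. ereal (f x)) \<longlongrightarrow> ereal (f x)) (nhds x)" by (rule tendsto_ereal)
  then show "\<forall>\<^sub>F y in nhds x. c < ereal (f y)" using c by (rule order_tendstoD(1))
qed

lemma lower_semicont_cmult:
  assumes "lower_semicont h" "0 < (c::real)"
  shows "lower_semicont (\<lambda>x. ereal c * h x)"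
  unfolding lower_semicont_iff
proof (intro allI impI)
  fix x d assume d: "d < ereal c * h x"
  have eq: "d < ereal c * y \<longleftrightarrow> d / ereal c < y" for y
    using assms(2) by (metis ereal_divide_less_pos ereal_less(2) less_ereal.simps(4) PInfty_neq_ereal(1) infinity_ereal_def ereal_less_PInfty less_PInf_Ex_of_nat)
  then show "\<forall>\<^sub>F y in nhds x. d < ereal c * h y"
    using assms(1) d unfolding lower_semicont_iff eq by blast
qed

section \<open>The proximal operator\<close>

lemma ereal_convex_real:
  assumes "ereal_convex h" "h x = ereal a" "h y = ereal b" "0 \<le> u" "0 \<le> v" "u + v = 1"
  shows "h (u *\<^sub>R x + v *\<^sub>R y) \<le> ereal (u * a + v * b)"
  using assms unfolding ereal_convex_def by (metis times_ereal.simps(1) plus_ereal.simps(1))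

lemma ereal_convex_cmult:
  assumes "ereal_convex h" "proper_fun h" "0 < (c::real)"
  shows "ereal_convex (\<lambda>x. ereal c * h x)"
  unfolding ereal_convex_def
proof (intro allI impI)
  fix x y and u v :: real assume uv: "0 \<le> u" "0 \<le> v" "u + v = 1"
  have le: "ereal c * h (u *\<^sub>R x + v *\<^sub>R y) \<le> ereal c * (ereal u * h x + ereal v * h y)"
    using assms uv unfolding ereal_convex_def by (intro ereal_mult_left_mono) auto
  have "h x \<noteq> -\<infinity>" "h y \<noteq> -\<infinity>" using assms(2) unfolding proper_fun_def by auto
  then have "ereal u * h x \<noteq> -\<infinity>" "ereal v * h y \<noteq> -\<infinity>" using uv by (auto simp: ereal_mult_eq_MInfty)
  then have "ereal c * (ereal u * h x + ereal v * h y)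
      = ereal c * (ereal u * h x) + ereal c * (ereal v * h y)"
    using assms(3) by (intro ereal_pos_distrib) auto
  with le show "ereal c * h (u *\<^sub>R x + v *\<^sub>R y) \<le> ereal u * (ereal c * h x) + ereal v * (ereal c * h y)"
    by (simp add: mult_ac)
qed

lemma proper_fun_cmult:
  assumes "proper_fun h" "0 < (c::real)"
  shows "proper_fun (\<lambda>x. ereal c * h x)"
  using assms unfolding proper_fun_def
  by (auto simp: ereal_mult_eq_MInfty ereal_mult_eq_PInfty)

text \<open>On the unit ball around a point of the domain the function has a minimum, and convexity along
  rays propagates this lower bound to the whole space with at most linear decay.\<close>

lemma convex_lsc_linear_lower_bound:
  fixes h :: "'v::euclidean_space \<Rightarrow> ereal"
  assumes "ereal_convex h" "proper_fun h" "lower_semicont h"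
  obtains C x0 r where "0 \<le> C" "h x0 = ereal r" "\<And>y. ereal (- C * (1 + norm (y - x0))) \<le> h y"
proof -
  obtain x0 r where x0: "h x0 = ereal r"
    using assms(2) unfolding proper_fun_def by (metis ereal_cases)
  obtain q where q: "q \<in> cball x0 1" "\<And>y. y \<in> cball x0 1 \<Longrightarrow> h q \<le> h y"
    using lower_semicont_attains_inf[OF assms(3), of "cball x0 1"] by auto
  have "h q \<le> ereal r" using q(2)[of x0] x0 by simp
  then obtain m where m: "h q = ereal m"
    using assms(2) unfolding proper_fun_def by (cases "h q") auto
  define C where "C = \<bar>m\<bar> + \<bar>r\<bar>"
  have "ereal (- C * (1 + norm (y - x0))) \<le> h y" for y
  proof (cases "norm (y - x0) \<le> 1")
    case True
    have "- C * (1 + norm (y - x0)) \<le> - C * 1"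
      unfolding C_def by (intro mult_left_mono_neg) auto
    also have "\<dots> \<le> m" unfolding C_def by simp
    finally have "ereal (- C * (1 + norm (y - x0))) \<le> h q" using m by simp
    then show ?thesis using q(2)[of y] True by (simp add: dist_norm norm_minus_commute)
  next
    case False
    define t where "t = norm (y - x0)"
    have t: "1 < t" using False by (simp add: t_def)
    show ?thesis
    proof (cases "h y")
      case (real b)
      define p where "p = (1 - 1 / t) *\<^sub>R x0 + (1 / t) *\<^sub>R y"
      have "p - x0 = (1 / t) *\<^sub>R (y - x0)" unfolding p_def by (simp add: algebra_simps)
      then have "norm (p - x0) = 1" using t by (auto simp: t_def)
      then have "ereal m \<le> h p" using q(2)[of p] m by (simp add: dist_norm norm_minus_commute)
      also have "h p \<le> ereal ((1 - 1 / t) * r + (1 / t) * b)"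
        unfolding p_def using t by (intro ereal_convex_real assms x0 real) auto
      finally have "m \<le> (1 - 1 / t) * r + (1 / t) * b" by simp
      then have "t * m \<le> (t - 1) * r + b" using t by (simp add: field_simps)
      moreover have "(t - 1) * r \<le> t * \<bar>r\<bar>"
        using t mult_left_mono[of r "\<bar>r\<bar>" "t - 1"] mult_right_mono[of "t - 1" t "\<bar>r\<bar>"] by linarith
      moreover have "- (t * \<bar>m\<bar>) \<le> t * m" using t mult_left_mono[of "- \<bar>m\<bar>" m t] by simp
      moreover have "C * (1 + t) = C + t * \<bar>m\<bar> + t * \<bar>r\<bar>" "0 \<le> C" by (simp_all add: C_def algebra_simps)
      ultimately show ?thesis using real unfolding t_def[symmetric] by simp
    qed (use assms(2) in \<open>auto simp: proper_fun_def\<close>)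
  qed
  moreover have "0 \<le> C" by (simp add: C_def)
  ultimately show ?thesis using that x0 by blast
qed

text \<open>The quadratic term dominates the linear lower bound, so that the search for a minimum may be
  restricted to a ball.\<close>

lemma prox_objective_minimum:
  fixes h :: "'v::euclidean_space \<Rightarrow> ereal"
  assumes h: "ereal_convex h" "proper_fun h" "lower_semicont h"
  shows "\<exists>p. \<forall>y. h p + ereal (1 / 2 * (norm (p - x))\<^sup>2) \<le> h y + ereal (1 / 2 * (norm (y - x))\<^sup>2)"
proof -
  obtain C x0 r where C: "0 \<le> C" "h x0 = ereal r" "\<And>y. ereal (- C * (1 + norm (y - x0))) \<le> h y"
    using convex_lsc_linear_lower_bound[OF h] by metis
  define f where "f y = h y + ereal (1 / 2 * (norm (y - x))\<^sup>2)" for y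
  have lsc: "lower_semicont f" unfolding f_def
  proof (intro lower_semicont_add h(3))
    show "lower_semicont (\<lambda>y. ereal (1 / 2 * (norm (y - x))\<^sup>2))"
      by (intro lower_semicont_continuous continuous_intros)
  qed (use h(2) in \<open>auto simp: proper_fun_def\<close>)
  define \<delta> where "\<delta> = norm (x - x0)"
  define S where "S = C * (1 + \<delta>) + \<bar>r + 1 / 2 * \<delta>\<^sup>2\<bar>"
  have "0 \<le> \<delta>" by (simp add: \<delta>_def)
  have S: "0 \<le> S" unfolding S_def using C(1) \<open>0 \<le> \<delta>\<close> by simp
  \<comment> \<open>Outside the ball of radius \<open>R\<close> around \<open>x\<close> the objective is at least its value at \<open>x0\<close>.\<close>
  define R where "R = 2 * C + 2 + 2 * S + \<delta>"
  have R: "R \<ge> 2 * C + 2 + 2 * S" "R \<ge> \<delta>" unfolding R_def using C(1) \<open>0 \<le> \<delta>\<close> S by auto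
  obtain p where p: "\<And>y. y \<in> cball x R \<Longrightarrow> f p \<le> f y"
    using lower_semicont_attains_inf[OF lsc, of "cball x R"] R C(1) S by force
  have fx0: "f x0 = ereal (r + 1 / 2 * \<delta>\<^sup>2)"
    unfolding f_def C(2) by (simp add: \<delta>_def norm_minus_commute)
  have "f p \<le> f y" for y
  proof (cases "y \<in> cball x R")
    case False
    define t where "t = norm (y - x)"
    have t: "t > R" using False by (simp add: t_def dist_norm norm_minus_commute)
    have "f p \<le> f x0" using p[of x0] R by (simp add: \<delta>_def dist_norm)
    also have "f x0 \<le> ereal (- C * (1 + norm (y - x0)) + 1 / 2 * t\<^sup>2)"
    proof -
      have "norm (y - x0) \<le> t + \<delta>" unfolding t_def \<delta>_def
        using norm_triangle_ineq[of "y - x" "x - x0"] by simp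
      then have "C * (1 + norm (y - x0)) \<le> C * (1 + \<delta>) + C * t"
        using C(1) mult_left_mono[of "norm (y - x0)" "t + \<delta>" C] by (simp add: algebra_simps)
      moreover have "t * (1 + S) \<le> t * (t / 2 - C)" using t R S C by (intro mult_left_mono) auto
      moreover have "1 * (1 + S) \<le> t * (1 + S)" using t R S C by (intro mult_right_mono) auto
      ultimately have "S + C * (1 + norm (y - x0)) \<le> C * (1 + \<delta>) + 1 / 2 * t\<^sup>2"
        by (simp add: algebra_simps power2_eq_square)
      then show ?thesis
        unfolding fx0 S_def using abs_ge_self[of "r + 1 / 2 * \<delta>\<^sup>2"] by simp
    qed
    also have "\<dots> \<le> f y" unfolding f_def t_def using add_mono[OF C(3)[of y] order_refl[of "ereal (1 / 2 * (norm (y - x))\<^sup>2)"]] by simp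
    finally show ?thesis .
  qed (use p in blast)
  then show ?thesis unfolding f_def by blast
qed

text \<open>The first-order optimality condition: compare the minimizer with the points of the segment
  towards \<open>y\<close> and let the segment shrink.\<close>

lemma prox_subdifferential:
  fixes h :: "'v::euclidean_space \<Rightarrow> ereal"
  assumes h: "ereal_convex h" "proper_fun h" "lower_semicont h"
  shows "x - prox h x \<in> subdifferential h (prox h x)"
proof -
  define p where "p = prox h x"
  define f where "f y = h y + ereal (1 / 2 * (norm (y - x))\<^sup>2)" for y
  have "\<exists>p. is_arg_min f (\<lambda>_. True) p"
    using prox_objective_minimum[OF h, of x] unfolding f_def is_arg_min_def by (simp add: not_less)
  then have "is_arg_min f (\<lambda>_. True) p"
    unfolding p_def prox_def arg_min_def f_def by (rule someI_ex)
  then have p: "f p \<le> f y" for y unfolding is_arg_min_def by (auto simp: not_less)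
  obtain y0 b0 where y0: "h y0 = ereal b0"
    using h(2) unfolding proper_fun_def by (metis ereal_cases)
  obtain a where a: "h p = ereal a"
    using p[of y0] y0 h(2) unfolding f_def proper_fun_def by (cases "h p") auto
  have "h p + ereal ((x - p) \<bullet> (y - p)) \<le> h y" for y
  proof (cases "h y")
    case (real b)
    have key: "(x - p) \<bullet> (y - p) \<le> b - a + t * (1 / 2 * (norm (y - p))\<^sup>2)" if t: "0 < t" "t \<le> 1" for t :: real
    proof -
      define q where "q = (1 - t) *\<^sub>R p + t *\<^sub>R y"
      have hq: "h q \<le> ereal ((1 - t) * a + t * b)"
        unfolding q_def using t by (intro ereal_convex_real h a real) auto
      have "ereal a + ereal (1 / 2 * (norm (p - x))\<^sup>2) \<le> ereal ((1 - t) * a + t * b) + ereal (1 / 2 * (norm (q - x))\<^sup>2)"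
        using p[of q] add_mono[OF hq order_refl] unfolding f_def a by (rule order_trans)
      then have "a + 1 / 2 * (norm (p - x))\<^sup>2 \<le> (1 - t) * a + t * b + 1 / 2 * (norm (q - x))\<^sup>2" by simp
      moreover have "q - x = (p - x) + t *\<^sub>R (y - p)" unfolding q_def by (simp add: algebra_simps)
      moreover have "(norm ((p - x) + t *\<^sub>R (y - p)))\<^sup>2
        = (norm (p - x))\<^sup>2 + 2 * t * ((p - x) \<bullet> (y - p)) + t * (t * (norm (y - p))\<^sup>2)"
        unfolding power2_norm_eq_inner by (simp add: inner_add inner_commute algebra_simps)
      ultimately have "t * ((x - p) \<bullet> (y - p)) \<le> t * (b - a + t * (1 / 2 * (norm (y - p))\<^sup>2))"
        using inner_minus_left[of "p - x" "y - p"] by (simp add: algebra_simps)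
      then show ?thesis using t by simp
    qed
    have "(x - p) \<bullet> (y - p) \<le> b - a"
    proof (rule tendsto_lowerbound)
      show "((\<lambda>t. b - a + t * (1 / 2 * (norm (y - p))\<^sup>2)) \<longlongrightarrow> b - a) (at_right 0)"
        by (auto intro!: tendsto_eq_intros)
      show "\<forall>\<^sub>F t in at_right 0. (x - p) \<bullet> (y - p) \<le> b - a + t * (1 / 2 * (norm (y - p))\<^sup>2)"
        unfolding eventually_at_right_field using key by (intro exI[of _ 1]) auto
    qed simp
    then show ?thesis using a real by simp
  qed (use h(2) in \<open>auto simp: proper_fun_def\<close>)
  then show ?thesis unfolding subdifferential_def p_def by blast
qed

lemma subdifferential_cmult:
  assumes "0 < (c::real)" "g \<in> subdifferential (\<lambda>x. ereal c * h x) x"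
  shows "(1 / c) *\<^sub>R g \<in> subdifferential h x"
  unfolding subdifferential_def
proof (intro CollectI allI)
  fix y
  have "ereal c * h x + ereal (g \<bullet> (y - x)) \<le> ereal c * h y"
    using assms(2) unfolding subdifferential_def by blast
  then show "h x + ereal ((1 / c) *\<^sub>R g \<bullet> (y - x)) \<le> h y"
    using assms(1) by (cases "h x"; cases "h y") (auto simp: field_simps)
qed

lemma prox_cmult_subdifferential:
  fixes h :: "'v::euclidean_space \<Rightarrow> ereal"
  assumes "ereal_convex h" "proper_fun h" "lower_semicont h" "0 < c" "p = prox (\<lambda>w. ereal c * h w) x"
  shows "(1 / c) *\<^sub>R (x - p) \<in> subdifferential h p"
  unfolding assms(5)
  by (intro subdifferential_cmult prox_subdifferential ereal_convex_cmult proper_fun_cmult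
      lower_semicont_cmult assms)

lemma subdifferential_finite:
  assumes "proper_fun h" "g \<in> subdifferential h x"
  obtains a where "h x = ereal a"
proof -
  obtain y where "h y \<noteq> \<infinity>" using assms(1) unfolding proper_fun_def by auto
  moreover have "h x + ereal (g \<bullet> (y - x)) \<le> h y" using assms(2) unfolding subdifferential_def by blast
  ultimately show ?thesis using that assms(1) unfolding proper_fun_def by (cases "h x") auto
qed

lemma subdifferential_real:
  assumes "g \<in> subdifferential h x" "h x = ereal a" "h y = ereal b"
  shows "a + g \<bullet> (y - x) \<le> b"
proof -
  have "h x + ereal (g \<bullet> (y - x)) \<le> h y" using assms(1) unfolding subdifferential_def by blast
  then show ?thesis using assms(2,3) by simp
qed

text \<open>The values of \<open>h\<close> cancel in the sum of the three subgradient inequalities. In the analysis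
  below the cycle runs through the new iterate, the solution and the extrapolated point.\<close>

lemma subdifferential_cyclically_monotone:
  assumes "proper_fun h" "g1 \<in> subdifferential h x1" "g2 \<in> subdifferential h x2" "g3 \<in> subdifferential h x3"
  shows "g1 \<bullet> (x2 - x1) + g2 \<bullet> (x3 - x2) + g3 \<bullet> (x1 - x3) \<le> 0"
proof -
  obtain a1 a2 a3 where a: "h x1 = ereal a1" "h x2 = ereal a2" "h x3 = ereal a3"
    using subdifferential_finite[OF assms(1)] assms(2-4) by metis
  show ?thesis
    using subdifferential_real[OF assms(2) a(1,2)] subdifferential_real[OF assms(3) a(2,3)]
      subdifferential_real[OF assms(4) a(3,1)] by linarith
qed

text \<open>Non-expansiveness makes the proximal operator continuous, hence measurable, which is how the
  iterates become random variables.\<close>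

lemma prox_nonexpansive:
  fixes h :: "'v::euclidean_space \<Rightarrow> ereal"
  assumes h: "ereal_convex h" "proper_fun h" "lower_semicont h"
  shows "norm (prox h x - prox h y) \<le> norm (x - y)"
proof -
  define p q where "p = prox h x" and "q = prox h y"
  have "(x - p) \<bullet> (q - p) + (y - q) \<bullet> (p - q) \<le> 0"
    using subdifferential_cyclically_monotone[OF h(2) prox_subdifferential[OF h, of x] prox_subdifferential[OF h, of y]
        prox_subdifferential[OF h, of y]]
    unfolding p_def q_def by simp
  then have "(norm (p - q))\<^sup>2 \<le> (x - y) \<bullet> (p - q)"
    unfolding power2_norm_eq_inner by (simp add: inner_diff inner_commute algebra_simps)
  also have "\<dots> \<le> norm (x - y) * norm (p - q)" by (rule norm_cauchy_schwarz)
  finally show ?thesis unfolding p_def[symmetric] q_def[symmetric] power2_eq_square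
    by (metis mult_le_cancel_right norm_ge_zero norm_eq_zero order.order_iff_strict)
qed

lemma continuous_on_prox:
  fixes h :: "'v::euclidean_space \<Rightarrow> ereal"
  assumes "ereal_convex h" "proper_fun h" "lower_semicont h"
  shows "continuous_on UNIV (prox h)"
proof -
  have "1-lipschitz_on UNIV (prox h)"
    using prox_nonexpansive[OF assms] by (intro lipschitz_onI) (auto simp: dist_norm)
  then show ?thesis by (rule lipschitz_on_continuous_on)
qed

section \<open>Measurability of the residual\<close>

lemma subdifferential_closed_graph:
  assumes "proper_fun h" "lower_semicont h"
    and "X \<longlonglongrightarrow> x" "g \<longlonglongrightarrow> g'" "\<And>n. g n \<in> subdifferential h (X n)"
  shows "g' \<in> subdifferential h x"
  unfolding subdifferential_def
proof (intro CollectI allI)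
  fix y
  show "h x + ereal (g' \<bullet> (y - x)) \<le> h y"
  proof (cases "h y")
    case (real b)
    have "h x \<le> ereal (b - g' \<bullet> (y - x))"
    proof (rule lower_semicont_seq_le[OF assms(2,3)])
      show "(\<lambda>n. ereal (b - g n \<bullet> (y - X n))) \<longlonglongrightarrow> ereal (b - g' \<bullet> (y - x))"
        by (intro tendsto_intros assms(3,4))
      show "h (X n) \<le> ereal (b - g n \<bullet> (y - X n))" for n
      proof -
        obtain a where a: "h (X n) = ereal a" using subdifferential_finite[OF assms(1) assms(5)] .
        show ?thesis using subdifferential_real[OF assms(5) a real] a by simp
      qed
    qed
    then show ?thesis using real by (cases "h x") auto
  qed (use assms(1) in \<open>auto simp: proper_fun_def\<close>)
qed

text \<open>The residual is lower semicontinuous: a bounded sequence of elements of the values of the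
  operator has a limit point, which belongs to the operator since its graph is closed.\<close>

lemma closed_residual_sublevel:
  fixes h :: "'v::euclidean_space \<Rightarrow> ereal"
  assumes h: "proper_fun h" "lower_semicont h" and F: "continuous_on UNIV F"
    and r: "0 \<le> r"
  shows "closed {z. dist_set 0 (op_sum F (subdifferential h) z) \<le> ennreal r}"
  unfolding closed_sequential_limits
proof (intro allI impI CollectI, elim conjE)
  fix X z assume mem: "\<forall>n. X n \<in> {z. dist_set 0 (op_sum F (subdifferential h) z) \<le> ennreal r}"
    and lim: "X \<longlonglongrightarrow> z"
  have "\<exists>u. u \<in> op_sum F (subdifferential h) (X n) \<and> norm u \<le> r + 1 / real (Suc n)" for n
  proof -
    have "dist_set 0 (op_sum F (subdifferential h) (X n)) < ennreal (r + 1 / real (Suc n))"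
    proof (rule order.strict_trans1)
      show "dist_set 0 (op_sum F (subdifferential h) (X n)) \<le> ennreal r" using mem by simp
      show "ennreal r < ennreal (r + 1 / real (Suc n))" using r by (intro ennreal_lessI add_nonneg_pos) auto
    qed
    then obtain u where "u \<in> op_sum F (subdifferential h) (X n)"
      "ennreal (norm (0 - u)) < ennreal (r + 1 / real (Suc n))"
      unfolding dist_set_def INF_less_iff by blast
    then have "norm u < r + 1 / real (Suc n)"
      using ennreal_less_iff[of "norm u"] by simp
    then show ?thesis using \<open>u \<in> _\<close> less_imp_le by blast
  qed
  then obtain u where u: "\<And>n. u n \<in> op_sum F (subdifferential h) (X n)"
    "\<And>n. norm (u n) \<le> r + 1 / real (Suc n)" by metis
  have "norm (u n) \<le> r + 1" for n using u(2)[of n] by (rule order_trans) auto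
  then have "\<forall>n. u n \<in> cball 0 (r + 1)" by simp
  then obtain v s where s: "strict_mono s" "(u \<circ> s) \<longlonglongrightarrow> v"
    using compact_cball[of "0::'v" "r + 1"] unfolding compact_def by metis
  have X: "(X \<circ> s) \<longlonglongrightarrow> z" using lim s(1) by (rule LIMSEQ_subseq_LIMSEQ)
  have "isCont F z" using F by (simp add: continuous_on_eq_continuous_at)
  then have FX: "(\<lambda>n. F ((X \<circ> s) n)) \<longlonglongrightarrow> F z" using X by (rule isCont_tendsto_compose)
  have "v - F z \<in> subdifferential h z"
  proof (rule subdifferential_closed_graph[OF h X])
    show "(\<lambda>n. (u \<circ> s) n - F ((X \<circ> s) n)) \<longlonglongrightarrow> v - F z" by (intro tendsto_diff s FX)
    show "(u \<circ> s) n - F ((X \<circ> s) n) \<in> subdifferential h ((X \<circ> s) n)" for n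
      using u(1)[of "s n"] unfolding op_sum_def by auto
  qed
  then have "v \<in> op_sum F (subdifferential h) z"
    unfolding op_sum_def by (auto intro!: exI[of _ "v - F z"])
  moreover have "norm v \<le> r"
  proof (rule LIMSEQ_le[OF tendsto_norm[OF s(2)]])
    have "(\<lambda>n. r + 1 / real (Suc n)) \<longlonglongrightarrow> r + 0"
      by (intro tendsto_intros LIMSEQ_Suc[OF lim_1_over_n])
    then show "((\<lambda>n. r + 1 / real (Suc n)) \<circ> s) \<longlonglongrightarrow> r"
      using LIMSEQ_subseq_LIMSEQ[OF _ s(1)] by simp
    show "\<exists>N. \<forall>n\<ge>N. norm ((u \<circ> s) n) \<le> ((\<lambda>n. r + 1 / real (Suc n)) \<circ> s) n"
      using u(2) by auto
  qed
  ultimately show "dist_set 0 (op_sum F (subdifferential h) z) \<le> ennreal r"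
    unfolding dist_set_def by (intro INF_lower2[of v]) (auto intro!: ennreal_leI)
qed

lemma borel_measurable_residual:
  fixes h :: "'v::euclidean_space \<Rightarrow> ereal"
  assumes "proper_fun h" "lower_semicont h" "continuous_on UNIV F"
  shows "(\<lambda>z. dist_set 0 (op_sum F (subdifferential h) z)) \<in> borel_measurable borel"
proof (rule borel_measurableI_le)
  fix y :: ennreal
  show "{z \<in> space borel. dist_set 0 (op_sum F (subdifferential h) z) \<le> y} \<in> sets borel"
  proof (cases y)
    case (real r)
    then show ?thesis using borel_closed[OF closed_residual_sublevel[OF assms, of r]] real by simp
  qed simp
qed

section \<open>The saddle operator\<close>

lemma GDERIV_gradient:
  fixes f :: "'v::euclidean_space \<Rightarrow> real"
  assumes "f differentiable (at x)"
  shows "GDERIV f x :> gradient f x"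
proof -
  obtain f' where f': "(f has_derivative f') (at x)" using assms unfolding differentiable_def by blast
  define D where "D = (\<Sum>b\<in>Basis. f' b *\<^sub>R b)"
  interpret bounded_linear f' using f' by (rule has_derivative_bounded_linear)
  have "f' v = v \<bullet> D" for v
  proof -
    have "f' v = f' (\<Sum>b\<in>Basis. (v \<bullet> b) *\<^sub>R b)" by (simp add: euclidean_representation)
    also have "\<dots> = v \<bullet> D" unfolding D_def by (simp add: sum scale inner_sum_right mult.commute)
    finally show ?thesis .
  qed
  then have D: "GDERIV f x :> D" unfolding gderiv_def using f' by (metis (no_types, lifting) ext)
  have "D' = D" if "GDERIV f x :> D'" for D'
    using has_derivative_unique[OF that[unfolded gderiv_def] D[unfolded gderiv_def]]
    by (metis vector_eq_ldot)
  then show ?thesis unfolding gradient_def using D by (metis theI)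
qed

lemma convex_gradient_inequality:
  fixes f :: "'v::euclidean_space \<Rightarrow> real"
  assumes "convex_on UNIV f" "f differentiable (at x)"
  shows "f x + gradient f x \<bullet> (y - x) \<le> f y"
proof -
  define g where "g t = f (x + t *\<^sub>R (y - x))" for t
  have "convex_on UNIV g"
  proof (rule convex_onI)
    fix t a b :: real assume t: "0 < t" "t < 1"
    have "x + ((1 - t) *\<^sub>R a + t *\<^sub>R b) *\<^sub>R (y - x)
      = (1 - t) *\<^sub>R (x + a *\<^sub>R (y - x)) + t *\<^sub>R (x + b *\<^sub>R (y - x))"
      by (simp add: algebra_simps)
    then show "g ((1 - t) *\<^sub>R a + t *\<^sub>R b) \<le> (1 - t) * g a + t * g b"
      unfolding g_def using convex_onD[OF assms(1), of t] t by (metis UNIV_I less_imp_le)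
  qed simp
  moreover have "(g has_field_derivative gradient f x \<bullet> (y - x)) (at 0 within UNIV)"
  proof -
    have f: "(f has_derivative (\<lambda>v. v \<bullet> gradient f x)) (at (x + 0 *\<^sub>R (y - x)))"
      using GDERIV_gradient[OF assms(2)] unfolding gderiv_def by simp
    have "((\<lambda>t. x + t *\<^sub>R (y - x)) has_derivative (\<lambda>t. t *\<^sub>R (y - x))) (at 0)"
      by (auto intro!: derivative_eq_intros)
    from has_derivative_compose[OF this f] show ?thesis
      unfolding has_field_derivative_def g_def by (simp add: inner_commute mult_commute_abs)
  qed
  ultimately have "gradient f x \<bullet> (y - x) * (1 - 0) \<le> g 1 - g 0"
    by (intro convex_on_imp_above_tangent) auto
  then show ?thesis by (simp add: g_def)
qed

lemma differentiable_partial: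
  fixes \<Psi> :: "'a::real_normed_vector \<times> 'b::real_normed_vector \<Rightarrow> real"
  assumes "\<Psi> differentiable (at (x, y))"
  shows "(\<lambda>x. \<Psi> (x, y)) differentiable (at x)" "(\<lambda>y. \<Psi> (x, y)) differentiable (at y)"
proof -
  obtain D where D: "(\<Psi> has_derivative D) (at (x, y))" using assms unfolding differentiable_def by blast
  have "((\<lambda>x. (x, y)) has_derivative (\<lambda>v. (v, 0))) (at x)"
    "((\<lambda>y. (x, y)) has_derivative (\<lambda>v. (0, v))) (at y)"
    by (auto intro!: derivative_eq_intros)
  from this[THEN has_derivative_compose, OF D]
  show "(\<lambda>x. \<Psi> (x, y)) differentiable (at x)" "(\<lambda>y. \<Psi> (x, y)) differentiable (at y)"
    unfolding differentiable_def by blast+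
qed

text \<open>Adding the four gradient inequalities between the corners of the rectangle spanned by the two
  points makes the values of \<open>\<Psi>\<close> cancel.\<close>

lemma saddle_F_monotone:
  fixes \<Psi> :: "'a::euclidean_space \<times> 'b::euclidean_space \<Rightarrow> real"
  assumes cx: "\<And>y. convex_on UNIV (\<lambda>x. \<Psi> (x, y))" and cv: "\<And>x. concave_on UNIV (\<lambda>y. \<Psi> (x, y))"
    and df: "\<And>z. \<Psi> differentiable (at z)"
  shows "0 \<le> (saddle_F \<Psi> z - saddle_F \<Psi> z') \<bullet> (z - z')"
proof -
  obtain x y x' y' where z: "z = (x, y)" "z' = (x', y')" by (metis surj_pair)
  note X = convex_gradient_inequality[OF cx differentiable_partial(1)[OF df]]
  have Y: "\<Psi> (x, y') \<le> \<Psi> (x, y) + gradient (\<lambda>y. \<Psi> (x, y)) y \<bullet> (y' - y)" for x y y'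
  proof -
    have "GDERIV (\<lambda>y. \<Psi> (x, y)) y :> gradient (\<lambda>y. \<Psi> (x, y)) y"
      by (rule GDERIV_gradient[OF differentiable_partial(2)[OF df]])
    then have D: "GDERIV (\<lambda>y. - \<Psi> (x, y)) y :> - gradient (\<lambda>y. \<Psi> (x, y)) y"
      unfolding gderiv_def by (auto intro!: derivative_eq_intros)
    then have df': "(\<lambda>y. - \<Psi> (x, y)) differentiable (at y)"
      unfolding gderiv_def differentiable_def by blast
    have "gradient (\<lambda>y. - \<Psi> (x, y)) y = - gradient (\<lambda>y. \<Psi> (x, y)) y"
      using has_derivative_unique[OF D[unfolded gderiv_def] GDERIV_gradient[OF df', unfolded gderiv_def]]
      by (metis vector_eq_ldot)
    then show ?thesis
      using convex_gradient_inequality[OF cv[of x, unfolded concave_on_def] df', of y'] by simp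
  qed
  show ?thesis
    using X[of x y x'] X[of x' y' x] Y[of x y' y] Y[of x' y y']
    unfolding z saddle_F_def by (simp add: inner_diff algebra_simps)
qed

lemma sep_sum_convex:
  assumes "ereal_convex h1" "proper_fun h1" "ereal_convex h2" "proper_fun h2"
  shows "ereal_convex (sep_sum h1 h2)"
  unfolding ereal_convex_def
proof (intro allI impI)
  fix x y :: "'a \<times> 'b" and u v :: real assume uv: "0 \<le> u" "0 \<le> v" "u + v = 1"
  have nm: "h1 a \<noteq> -\<infinity>" "h2 b \<noteq> -\<infinity>" for a b using assms(2,4) unfolding proper_fun_def by auto
  have dist: "ereal w * (h1 a + h2 b) = ereal w * h1 a + ereal w * h2 b" if "0 \<le> w" for w a b
    using that nm by (intro ereal_pos_distrib) auto
  have "sep_sum h1 h2 (u *\<^sub>R x + v *\<^sub>R y)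
    \<le> (ereal u * h1 (fst x) + ereal v * h1 (fst y)) + (ereal u * h2 (snd x) + ereal v * h2 (snd y))"
    unfolding sep_sum_def using assms(1,3) uv unfolding ereal_convex_def by (intro add_mono) auto
  also have "\<dots> = ereal u * sep_sum h1 h2 x + ereal v * sep_sum h1 h2 y"
    unfolding sep_sum_def using dist uv by (simp add: ac_simps)
  finally show "sep_sum h1 h2 (u *\<^sub>R x + v *\<^sub>R y) \<le> ereal u * sep_sum h1 h2 x + ereal v * sep_sum h1 h2 y" .
qed

lemma sep_sum_proper:
  assumes "proper_fun h1" "proper_fun h2"
  shows "proper_fun (sep_sum h1 h2)"
proof -
  obtain x y where "h1 x \<noteq> \<infinity>" "h2 y \<noteq> \<infinity>" using assms unfolding proper_fun_def by auto
  then have "sep_sum h1 h2 (x, y) \<noteq> \<infinity>" unfolding sep_sum_def by simp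
  then show ?thesis using assms unfolding proper_fun_def sep_sum_def by auto
qed

lemma sep_sum_lower_semicont:
  fixes h1 :: "'a::topological_space \<Rightarrow> ereal" and h2 :: "'b::topological_space \<Rightarrow> ereal"
  assumes "lower_semicont h1" "proper_fun h1" "lower_semicont h2" "proper_fun h2"
  shows "lower_semicont (sep_sum h1 h2)"
  unfolding sep_sum_def[abs_def]
  by (intro lower_semicont_add lower_semicont_compose[OF assms(1)] lower_semicont_compose[OF assms(3)]
      continuous_on_fst continuous_on_snd continuous_on_id)
    (use assms(2,4) in \<open>auto simp: proper_fun_def\<close>)

lemma saddle_H_eq_subdifferential:
  assumes "proper_fun h1" "proper_fun h2"
  shows "saddle_H h1 h2 = subdifferential (sep_sum h1 h2)"
proof (intro ext set_eqI iffI)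
  fix z g
  assume "g \<in> saddle_H h1 h2 z"
  then have g: "fst g \<in> subdifferential h1 (fst z)" "snd g \<in> subdifferential h2 (snd z)"
    unfolding saddle_H_def by auto
  obtain a b where ab: "h1 (fst z) = ereal a" "h2 (snd z) = ereal b"
    using subdifferential_finite[OF assms(1) g(1)] subdifferential_finite[OF assms(2) g(2)] by metis
  show "g \<in> subdifferential (sep_sum h1 h2) z"
    unfolding subdifferential_def
  proof (intro CollectI allI)
    fix y
    have "h1 (fst z) + ereal (fst g \<bullet> (fst y - fst z)) + (h2 (snd z) + ereal (snd g \<bullet> (snd y - snd z)))
      \<le> h1 (fst y) + h2 (snd y)"
      using g unfolding subdifferential_def by (intro add_mono) auto
    then show "sep_sum h1 h2 z + ereal (g \<bullet> (y - z)) \<le> sep_sum h1 h2 y"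
      unfolding sep_sum_def inner_prod_def using ab by (simp add: ac_simps)
  qed
next
  fix z g
  assume g: "g \<in> subdifferential (sep_sum h1 h2) z"
  obtain c where "sep_sum h1 h2 z = ereal c"
    using subdifferential_finite[OF sep_sum_proper[OF assms] g] .
  then obtain a b where ab: "h1 (fst z) = ereal a" "h2 (snd z) = ereal b"
    using assms unfolding sep_sum_def proper_fun_def
    by (cases "h1 (fst z)"; cases "h2 (snd z)") auto
  have sub: "h1 (fst z) + h2 (snd z) + ereal (g \<bullet> (y - z)) \<le> h1 (fst y) + h2 (snd y)" for y
    using g unfolding subdifferential_def sep_sum_def by blast
  have "h1 (fst z) + ereal (fst g \<bullet> (x - fst z)) \<le> h1 x" for x
    using sub[of "(x, snd z)"] ab by (cases "h1 x") (auto simp: inner_prod_def)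
  moreover have "h2 (snd z) + ereal (snd g \<bullet> (y - snd z)) \<le> h2 y" for y
    using sub[of "(fst z, y)"] ab by (cases "h2 y") (auto simp: inner_prod_def)
  ultimately show "g \<in> saddle_H h1 h2 z"
    unfolding saddle_H_def subdifferential_def by (auto simp: mem_Times_iff)
qed

section \<open>Deterministic estimates for one iteration\<close>

lemma norm_add_power2_le:
  fixes x y :: "'v::real_inner"
  shows "(norm (x + y))\<^sup>2 \<le> 2 * (norm x)\<^sup>2 + 2 * (norm y)\<^sup>2"
proof -
  have "(norm (x + y))\<^sup>2 + (norm (x - y))\<^sup>2 = 2 * (norm x)\<^sup>2 + 2 * (norm y)\<^sup>2"
    unfolding power2_norm_eq_inner by (simp add: inner_add inner_diff inner_commute algebra_simps)
  then show ?thesis by (smt (verit) zero_le_power2)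
qed

lemma norm_add3_power2_le:
  fixes x y z :: "'v::real_inner"
  shows "(norm (x + y + z))\<^sup>2 \<le> 3 * (norm x)\<^sup>2 + 3 * (norm y)\<^sup>2 + 3 * (norm z)\<^sup>2"
proof -
  have "(norm (x + y + z))\<^sup>2 + (norm (x - y))\<^sup>2 + (norm (y - z))\<^sup>2 + (norm (x - z))\<^sup>2
    = 3 * (norm x)\<^sup>2 + 3 * (norm y)\<^sup>2 + 3 * (norm z)\<^sup>2"
    unfolding power2_norm_eq_inner by (simp add: inner_add inner_diff inner_commute algebra_simps)
  then show ?thesis by (smt (verit) zero_le_power2)
qed

lemma norm_convex_comb_diff_power2:
  fixes x y z :: "'v::real_inner"
  shows "(norm (\<beta> *\<^sub>R x + (1 - \<beta>) *\<^sub>R y - z))\<^sup>2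
    = \<beta> * (norm (x - z))\<^sup>2 + (1 - \<beta>) * (norm (y - z))\<^sup>2 - \<beta> * (1 - \<beta>) * (norm (y - x))\<^sup>2"
  unfolding power2_norm_eq_inner
  by (simp add: inner_add inner_diff inner_commute algebra_simps)

text \<open>The hypothesis is cyclic monotonicity combined with monotonicity of the operator: \<open>v\<close> stands
  for the operator at the extrapolated point \<open>w\<close>, and \<open>\<nu>\<close> for the oracle noise there. Expanding the
  inner products turns it into distances. The noise is paired with \<open>zp - zs\<close>, of which the part
  \<open>zb - zs\<close> is independent of the noise and stays linear, while the part \<open>zp - zb\<close> is absorbed by
  Young's inequality; the pairing of \<open>v - g\<close> with \<open>w - zp\<close> is absorbed by completing a square.\<close>

lemma two_step_prox_inequality:
  fixes zb zs w zp g v \<nu> :: "'v::real_inner"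
  assumes t: "0 < t" and \<gamma>: "0 < \<gamma>"
    and cyc: "(1 / (t * \<gamma>)) *\<^sub>R (zb - (t * \<gamma>) *\<^sub>R (v + \<nu>) - zp) \<bullet> (zs - zp)
      + (1 / \<gamma>) *\<^sub>R (zb - \<gamma> *\<^sub>R g - w) \<bullet> (zp - w) \<le> v \<bullet> (w - zs)"
  shows "(norm (zp - zs))\<^sup>2 \<le> (norm (zb - zs))\<^sup>2 - (3 / 4 - t) * (norm (zp - zb))\<^sup>2
    - t * (norm (w - zb))\<^sup>2 + t * \<gamma>\<^sup>2 * (norm (v - g))\<^sup>2
    + 4 * (t * \<gamma>)\<^sup>2 * (norm \<nu>)\<^sup>2 - 2 * (t * \<gamma>) * (\<nu> \<bullet> (zb - zs))"
proof -
  define \<eta> where "\<eta> = t * \<gamma>"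
  have \<eta>: "0 < \<eta>" using t \<gamma> by (simp add: \<eta>_def)
  have "\<eta> * ((1 / \<eta>) * ((zb - \<eta> *\<^sub>R (v + \<nu>) - zp) \<bullet> (zs - zp))
      + (1 / \<gamma>) * ((zb - \<gamma> *\<^sub>R g - w) \<bullet> (zp - w))) \<le> \<eta> * (v \<bullet> (w - zs))"
    using cyc \<eta> unfolding \<eta>_def[symmetric] by (intro mult_left_mono) auto
  then have *: "(zb - \<eta> *\<^sub>R (v + \<nu>) - zp) \<bullet> (zs - zp)
      + t * ((zb - \<gamma> *\<^sub>R g - w) \<bullet> (zp - w)) \<le> \<eta> * (v \<bullet> (w - zs))"
    using t \<gamma> by (simp add: distrib_left \<eta>_def)
  have lhs1: "2 * ((zb - \<eta> *\<^sub>R (v + \<nu>) - zp) \<bullet> (zs - zp))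
    = (norm (zp - zb))\<^sup>2 + (norm (zp - zs))\<^sup>2 - (norm (zb - zs))\<^sup>2
      - 2 * \<eta> * (v \<bullet> (zs - zp)) - 2 * \<eta> * (\<nu> \<bullet> (zs - zb)) - 2 * \<eta> * (\<nu> \<bullet> (zb - zp))"
    unfolding power2_norm_eq_inner by (simp add: inner_add inner_diff inner_commute algebra_simps)
  have "2 * ((zb - \<gamma> *\<^sub>R g - w) \<bullet> (zp - w))
    = (norm (w - zb))\<^sup>2 + (norm (zp - w))\<^sup>2 - (norm (zp - zb))\<^sup>2 - 2 * \<gamma> * (g \<bullet> (zp - w))"
    unfolding power2_norm_eq_inner by (simp add: inner_add inner_diff inner_commute algebra_simps)
  then have "t * (2 * ((zb - \<gamma> *\<^sub>R g - w) \<bullet> (zp - w)))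
    = t * ((norm (w - zb))\<^sup>2 + (norm (zp - w))\<^sup>2 - (norm (zp - zb))\<^sup>2 - 2 * \<gamma> * (g \<bullet> (zp - w)))"
    by simp
  then have lhs2: "2 * (t * ((zb - \<gamma> *\<^sub>R g - w) \<bullet> (zp - w)))
    = t * (norm (w - zb))\<^sup>2 + t * (norm (zp - w))\<^sup>2 - t * (norm (zp - zb))\<^sup>2 - 2 * \<eta> * (g \<bullet> (zp - w))"
    by (simp add: \<eta>_def algebra_simps)
  have young: "2 * \<eta> * (\<nu> \<bullet> (zb - zp)) \<le> 4 * \<eta>\<^sup>2 * (norm \<nu>)\<^sup>2 + 1 / 4 * (norm (zp - zb))\<^sup>2"
  proof -
    have "0 \<le> (norm ((2 * \<eta>) *\<^sub>R \<nu> - (1 / 2) *\<^sub>R (zb - zp)))\<^sup>2" by simp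
    also have "\<dots> = 4 * \<eta>\<^sup>2 * (norm \<nu>)\<^sup>2 + 1 / 4 * (norm (zp - zb))\<^sup>2 - 2 * \<eta> * (\<nu> \<bullet> (zb - zp))"
      unfolding power2_norm_eq_inner
      by (simp add: inner_add inner_diff inner_commute algebra_simps power2_eq_square)
    finally show ?thesis by simp
  qed
  have square: "2 * \<eta> * ((v - g) \<bullet> (w - zp)) - t * (norm (zp - w))\<^sup>2 \<le> t * \<gamma>\<^sup>2 * (norm (v - g))\<^sup>2"
  proof -
    have "0 \<le> t * (norm (\<gamma> *\<^sub>R (v - g) - (w - zp)))\<^sup>2" using t by simp
    also have "\<dots> = t * (\<gamma>\<^sup>2 * (norm (v - g))\<^sup>2 + (norm (zp - w))\<^sup>2 - 2 * \<gamma> * ((v - g) \<bullet> (w - zp)))"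
      unfolding power2_norm_eq_inner
      by (simp add: inner_add inner_diff inner_commute algebra_simps power2_eq_square)
    finally show ?thesis by (simp add: \<eta>_def algebra_simps)
  qed
  have "\<nu> \<bullet> (zs - zb) = - (\<nu> \<bullet> (zb - zs))" "v \<bullet> (w - zs) + v \<bullet> (zs - zp) = v \<bullet> (w - zp)"
    "g \<bullet> (zp - w) = - (g \<bullet> (w - zp))" "(v - g) \<bullet> (w - zp) = v \<bullet> (w - zp) - g \<bullet> (w - zp)"
    by (simp_all add: inner_diff algebra_simps)
  moreover from this(2) have "\<eta> * (v \<bullet> (w - zs)) + \<eta> * (v \<bullet> (zs - zp)) = \<eta> * (v \<bullet> (w - zp))"
    by (metis distrib_left)
  ultimately show ?thesis
    using * lhs1 lhs2 young square unfolding \<eta>_def[symmetric] by (simp add: algebra_simps)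
qed

text \<open>This is where the parameters matter. The letters \<open>A\<close>, \<open>C\<close>, \<open>D\<close>, \<open>E\<close> are the squared norms of
  \<open>w - zb\<close>, \<open>zp - zb\<close>, \<open>z - z0\<close> and of the estimator error; \<open>Z\<close> and \<open>Z0\<close> are the squared distances of
  \<open>z\<close> and \<open>z0\<close> to the solution. After multiplication by \<open>L\<^sup>2 * n\<close> each of the four quantities has a
  budget that covers what the estimator update, the noise and the residual cost: of order \<open>\<tau> * s * L\<^sup>2\<close> for
  \<open>A\<close> and \<open>L\<^sup>2 * n\<close> for \<open>C\<close> from the two proximal steps, \<open>L\<^sup>2\<close> for \<open>D\<close> from anchoring, and \<open>\<tau> * s\<close> for
  \<open>E\<close> from the contraction of the estimator error. The condition
  \<open>\<tau> * B\<^sup>2 \<le> L\<^sup>2 / 12\<close> keeps the noise that grows with the distance to \<open>z0\<close> within the budget of \<open>D\<close>.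
  The variable \<open>V\<close> enters separately from \<open>N\<close> because its term bounds the expectation of the term with \<open>N\<close>.\<close>

lemma step_size_budget:
  fixes n \<tau> L B G A C D E Z Z0 P X Y W V N l :: real
  assumes n: "3 \<le> n" and \<tau>: "0 < \<tau>" "\<tau> \<le> 1 / 4" "\<tau> * B\<^sup>2 \<le> L\<^sup>2 / 12" and L: "0 < L"
    and nonneg: "0 \<le> A" "0 \<le> C" "0 \<le> D" "0 \<le> E"
    and defs: "s = sqrt n" "t = \<tau> / s" "\<beta> = 1 / n" "\<gamma> = (1 - \<beta>) / (6 * L)" "\<alpha> = 2 / s"
    and P: "P \<le> (\<beta> * Z0 + (1 - \<beta>) * Z - \<beta> * (1 - \<beta>) * D) - (3 / 4 - t) * C - t * A + t * \<gamma>\<^sup>2 * X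
      + 4 * (t * \<gamma>)\<^sup>2 * N - 2 * (t * \<gamma>) * l"
    and X: "X \<le> 3 * L\<^sup>2 * A + 3 * L\<^sup>2 * \<beta>\<^sup>2 * D + 3 * E"
    and Y: "Y \<le> 2 * C + 2 * D" and W: "W \<le> 2 * C + 2 * \<beta>\<^sup>2 * D" and V: "V \<le> 2 * A + 2 * D"
  shows "L\<^sup>2 * n * P + \<tau> / 8 * n * ((1 - \<alpha>)\<^sup>2 * E + (2 * \<alpha>\<^sup>2 * (B\<^sup>2 * Y + G\<^sup>2) + 2 * (1 - \<alpha>)\<^sup>2 * (L\<^sup>2 * W)))
      + 1 / 814 * \<tau> * s * (168 * L\<^sup>2 * A + 6 * L\<^sup>2 * \<beta>\<^sup>2 * D + 6 * E)
      + L\<^sup>2 * n * (4 * (t * \<gamma>)\<^sup>2) * (B\<^sup>2 * V + G\<^sup>2)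
    \<le> L\<^sup>2 * (n - 1) * Z + \<tau> / 8 * (n - 1) * E + (L\<^sup>2 * Z0 + (\<tau> + 2)\<^sup>2 * G\<^sup>2)
      + L\<^sup>2 * n * (4 * (t * \<gamma>)\<^sup>2) * N - 2 * (L\<^sup>2 * n * (t * \<gamma>)) * l"
proof -
  have s2: "s * s = n" and spos: "0 < s" using n by (auto simp: defs(1))
  have s17: "17 / 10 \<le> s" unfolding defs(1) by (rule real_le_rsqrt) (use n in \<open>simp add: power2_eq_square\<close>)
  have sn: "s \<le> n" using mult_right_mono[of 1 s s] s2 s17 by simp
  have \<beta>: "0 < \<beta>" "\<beta> \<le> 1 / 3" "n * \<beta> = 1" using n unfolding defs(3) by (auto simp: field_simps)
  have nt: "n * t = \<tau> * s" unfolding s2[symmetric] defs(2) using spos by simp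
  have nt2: "n * t\<^sup>2 = \<tau>\<^sup>2" unfolding s2[symmetric] defs(2) using spos by (simp add: power2_eq_square)
  have \<gamma>2: "L\<^sup>2 * \<gamma>\<^sup>2 = (1 - \<beta>)\<^sup>2 / 36" using L by (simp add: defs(4) power_divide power_mult_distrib)
  have \<beta>2: "(1 - \<beta>)\<^sup>2 \<le> 1" using \<beta> by (simp add: power_le_one)
  have na2: "n * \<alpha>\<^sup>2 = 4" unfolding s2[symmetric] defs(5) using spos by (simp add: power2_eq_square)
  have nal: "n * (1 - \<alpha>)\<^sup>2 = n - 4 * s + 4"
    unfolding s2[symmetric] defs(5) using spos by (simp add: power2_eq_square field_simps)
  have al1: "(1 - \<alpha>)\<^sup>2 \<le> 1"
  proof -
    have "0 \<le> \<alpha>" "\<alpha> \<le> 2" using spos s17 unfolding defs(5) by (auto simp: field_simps)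
    then show ?thesis by (simp add: abs_square_le_1)
  qed
  \<comment> \<open>The anchored energy inequality, multiplied by \<open>L\<^sup>2 * n\<close>.\<close>
  have "L\<^sup>2 * n * P \<le> L\<^sup>2 * n * ((\<beta> * Z0 + (1 - \<beta>) * Z - \<beta> * (1 - \<beta>) * D) - (3 / 4 - t) * C - t * A
      + t * \<gamma>\<^sup>2 * X + 4 * (t * \<gamma>)\<^sup>2 * N - 2 * (t * \<gamma>) * l)"
    using P n L by (intro mult_left_mono) auto
  also have "\<dots> = L\<^sup>2 * (n * \<beta>) * Z0 + L\<^sup>2 * (n - n * \<beta>) * Z - L\<^sup>2 * (n * \<beta>) * (1 - \<beta>) * D
      - L\<^sup>2 * n * (3 / 4) * C + L\<^sup>2 * (n * t) * C - L\<^sup>2 * (n * t) * A + (n * t) * (L\<^sup>2 * \<gamma>\<^sup>2) * X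
      + L\<^sup>2 * n * (4 * (t * \<gamma>)\<^sup>2) * N - 2 * (L\<^sup>2 * n * (t * \<gamma>)) * l"
    by (simp add: algebra_simps)
  finally have P': "L\<^sup>2 * n * P \<le> L\<^sup>2 * Z0 + L\<^sup>2 * (n - 1) * Z - L\<^sup>2 * (1 - \<beta>) * D
      - 3 / 4 * (L\<^sup>2 * n * C) + L\<^sup>2 * (n * t) * C - \<tau> * s * L\<^sup>2 * A + (\<tau> * s) * ((1 - \<beta>)\<^sup>2 / 36) * X
      + L\<^sup>2 * n * (4 * (t * \<gamma>)\<^sup>2) * N - 2 * (L\<^sup>2 * n * (t * \<gamma>)) * l"
    unfolding nt \<gamma>2 \<beta>(3) by (simp add: algebra_simps)
  \<comment> \<open>From here on, one bound for each cost.\<close>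
  have T0: "L\<^sup>2 * (n * t) * C \<le> 3 / 20 * (L\<^sup>2 * n * C)"
  proof -
    have "t \<le> 3 / 20" using \<tau> s17 unfolding defs(2) by (simp add: divide_le_eq)
    then have "t * (L\<^sup>2 * n * C) \<le> 3 / 20 * (L\<^sup>2 * n * C)"
      using n nonneg by (intro mult_right_mono) auto
    then show ?thesis by (simp add: mult_ac)
  qed
  define R where "R = 3 * L\<^sup>2 * A + 3 * L\<^sup>2 * \<beta>\<^sup>2 * D + 3 * E"
  have R: "0 \<le> R" using nonneg by (auto simp: R_def)
  have T1: "(\<tau> * s) * ((1 - \<beta>)\<^sup>2 / 36) * X \<le> \<tau> * s / 36 * R"
  proof -
    have "(\<tau> * s) * ((1 - \<beta>)\<^sup>2 / 36) * X \<le> (\<tau> * s) * ((1 - \<beta>)\<^sup>2 / 36) * R"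
      unfolding R_def using \<tau> spos by (intro mult_left_mono X) auto
    also have "\<dots> \<le> (\<tau> * s) * (1 / 36) * R"
      using \<tau> spos R \<beta>2 by (intro mult_right_mono mult_left_mono) auto
    finally show ?thesis by simp
  qed
  have T2: "\<tau> * B\<^sup>2 * Y \<le> L\<^sup>2 / 6 * C + L\<^sup>2 / 6 * D"
  proof -
    have "\<tau> * B\<^sup>2 * Y \<le> \<tau> * B\<^sup>2 * (2 * C + 2 * D)" using \<tau> by (intro mult_left_mono Y) auto
    also have "\<dots> \<le> L\<^sup>2 / 12 * (2 * C + 2 * D)" using \<tau> nonneg by (intro mult_right_mono) auto
    finally show ?thesis by (simp add: algebra_simps)
  qed
  have T3: "\<tau> / 4 * n * (1 - \<alpha>)\<^sup>2 * (L\<^sup>2 * W) \<le> 1 / 8 * (L\<^sup>2 * n * C) + L\<^sup>2 / 8 * (\<beta> * D)"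
  proof -
    have "\<tau> / 4 * n * (1 - \<alpha>)\<^sup>2 * (L\<^sup>2 * W) \<le> \<tau> / 4 * n * (1 - \<alpha>)\<^sup>2 * (L\<^sup>2 * (2 * C + 2 * \<beta>\<^sup>2 * D))"
      using \<tau> n by (intro mult_left_mono W) auto
    also have "\<dots> \<le> (1 / 4) / 4 * n * 1 * (L\<^sup>2 * (2 * C + 2 * \<beta>\<^sup>2 * D))"
      using \<tau> n nonneg al1 by (intro mult_right_mono mult_mono) auto
    also have "\<dots> = 1 / 8 * (L\<^sup>2 * n * C) + L\<^sup>2 / 8 * ((n * \<beta>) * \<beta> * D)"
      by (simp add: algebra_simps power2_eq_square)
    finally show ?thesis unfolding \<beta>(3) by simp
  qed
  \<comment> \<open>The contraction of the estimator error: \<open>n * (1 - \<alpha>)\<^sup>2 = (s - 2)\<^sup>2\<close> is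
    smaller than the old weight \<open>n - 1\<close> by \<open>4 * s - 5\<close>.\<close>
  have T4: "\<tau> / 8 * (n * (1 - \<alpha>)\<^sup>2) * E = \<tau> / 8 * n * E - 1 / 2 * (\<tau> * s * E) + 1 / 2 * (\<tau> * E)"
    unfolding nal by (simp add: algebra_simps)
  have Q: "L\<^sup>2 * n * (4 * (t * \<gamma>)\<^sup>2) \<le> \<tau>\<^sup>2 / 9"
  proof -
    have "L\<^sup>2 * n * (4 * (t * \<gamma>)\<^sup>2) = 4 * (n * t\<^sup>2) * (L\<^sup>2 * \<gamma>\<^sup>2)"
      by (simp add: power_mult_distrib algebra_simps)
    also have "\<dots> = \<tau>\<^sup>2 / 9 * (1 - \<beta>)\<^sup>2" unfolding nt2 \<gamma>2 by simp
    also have "\<dots> \<le> \<tau>\<^sup>2 / 9 * 1" by (intro mult_left_mono \<beta>2) auto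
    finally show ?thesis by simp
  qed
  have T5: "L\<^sup>2 * n * (4 * (t * \<gamma>)\<^sup>2) * (B\<^sup>2 * V + G\<^sup>2)
    \<le> 1 / 54 * (\<tau> * L\<^sup>2 * A) + 1 / 54 * (\<tau> * L\<^sup>2 * D) + \<tau>\<^sup>2 / 9 * G\<^sup>2"
  proof -
    have "L\<^sup>2 * n * (4 * (t * \<gamma>)\<^sup>2) * (B\<^sup>2 * V + G\<^sup>2) \<le> L\<^sup>2 * n * (4 * (t * \<gamma>)\<^sup>2) * (B\<^sup>2 * (2 * A + 2 * D) + G\<^sup>2)"
      using n by (intro mult_left_mono add_mono V) auto
    also have "\<dots> \<le> \<tau>\<^sup>2 / 9 * (B\<^sup>2 * (2 * A + 2 * D) + G\<^sup>2)"
      using nonneg by (intro mult_right_mono Q) auto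
    also have "\<dots> = \<tau> / 9 * ((\<tau> * B\<^sup>2) * (2 * A + 2 * D)) + \<tau>\<^sup>2 / 9 * G\<^sup>2"
      by (simp add: algebra_simps power2_eq_square)
    also have "\<dots> \<le> \<tau> / 9 * (L\<^sup>2 / 12 * (2 * A + 2 * D)) + \<tau>\<^sup>2 / 9 * G\<^sup>2"
      using \<tau> nonneg by (intro add_mono mult_left_mono mult_right_mono) auto
    also have "\<dots> = 1 / 54 * (\<tau> * L\<^sup>2 * A) + 1 / 54 * (\<tau> * L\<^sup>2 * D) + \<tau>\<^sup>2 / 9 * G\<^sup>2"
      by (simp add: field_simps)
    finally show ?thesis .
  qed
  \<comment> \<open>Comparisons between the monomials that remain.\<close>
  have A1: "\<tau> * L\<^sup>2 * A \<le> \<tau> * s * L\<^sup>2 * A" "0 \<le> \<tau> * L\<^sup>2 * A"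
    using mult_right_mono[of 1 s "\<tau> * L\<^sup>2 * A"] s17 \<tau> nonneg by (auto simp: mult_ac)
  have C1: "3 * (L\<^sup>2 * C) \<le> L\<^sup>2 * n * C" "0 \<le> L\<^sup>2 * C"
    using mult_right_mono[of 3 n "L\<^sup>2 * C"] n nonneg by (auto simp: mult_ac)
  have D1: "L\<^sup>2 * (\<beta> * D) \<le> 1 / 3 * (L\<^sup>2 * D)" "\<tau> * L\<^sup>2 * D \<le> 1 / 4 * (L\<^sup>2 * D)" "0 \<le> L\<^sup>2 * D"
    using mult_right_mono[of \<beta> "1 / 3" "L\<^sup>2 * D"] mult_right_mono[of \<tau> "1 / 4" "L\<^sup>2 * D"] \<beta> \<tau> nonneg
    by (auto simp: mult_ac)
  have D2: "\<tau> * s * L\<^sup>2 * \<beta>\<^sup>2 * D \<le> 1 / 12 * (L\<^sup>2 * D)"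
  proof -
    have "s * \<beta>\<^sup>2 \<le> n * \<beta>\<^sup>2" using sn by (intro mult_right_mono) auto
    also have "\<dots> = \<beta>" using \<beta>(3) by (simp add: power2_eq_square flip: mult.assoc)
    finally have "s * \<beta>\<^sup>2 \<le> 1 / 3" using \<beta>(2) by simp
    then have "\<tau> * (s * \<beta>\<^sup>2) \<le> 1 / 4 * (1 / 3)" using \<tau> spos by (intro mult_mono) auto
    then have "\<tau> * (s * \<beta>\<^sup>2) * (L\<^sup>2 * D) \<le> 1 / 12 * (L\<^sup>2 * D)"
      using nonneg by (intro mult_right_mono) auto
    then show ?thesis by (simp add: mult_ac)
  qed
  have E1: "17 / 10 * (\<tau> * E) \<le> \<tau> * s * E" "0 \<le> \<tau> * E"
    using mult_right_mono[of "17 / 10" s "\<tau> * E"] s17 \<tau> nonneg by (auto simp: mult_ac)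
  have G1: "\<tau> * G\<^sup>2 + \<tau>\<^sup>2 / 9 * G\<^sup>2 \<le> (\<tau> + 2)\<^sup>2 * G\<^sup>2"
  proof -
    have "(\<tau> + \<tau>\<^sup>2 / 9) * G\<^sup>2 \<le> (\<tau> + 2)\<^sup>2 * G\<^sup>2"
      using \<tau> by (intro mult_right_mono) (auto simp: power2_eq_square algebra_simps)
    then show ?thesis by (simp add: algebra_simps)
  qed
  have e1: "\<tau> / 8 * n * ((1 - \<alpha>)\<^sup>2 * E + (2 * \<alpha>\<^sup>2 * (B\<^sup>2 * Y + G\<^sup>2) + 2 * (1 - \<alpha>)\<^sup>2 * (L\<^sup>2 * W)))
    = \<tau> / 8 * (n * (1 - \<alpha>)\<^sup>2) * E + \<tau> / 4 * (n * \<alpha>\<^sup>2) * (B\<^sup>2 * Y + G\<^sup>2) + \<tau> / 4 * n * (1 - \<alpha>)\<^sup>2 * (L\<^sup>2 * W)"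
    by (simp add: algebra_simps)
  have e2: "\<tau> / 4 * (n * \<alpha>\<^sup>2) * (B\<^sup>2 * Y + G\<^sup>2) = \<tau> * B\<^sup>2 * Y + \<tau> * G\<^sup>2"
    unfolding na2 by (simp add: algebra_simps)
  have e3: "\<tau> * s / 36 * R = 1 / 12 * (\<tau> * s * L\<^sup>2 * A) + 1 / 12 * (\<tau> * s * L\<^sup>2 * \<beta>\<^sup>2 * D) + 1 / 12 * (\<tau> * s * E)"
    unfolding R_def by (simp add: algebra_simps)
  have e4: "1 / 814 * \<tau> * s * (168 * L\<^sup>2 * A + 6 * L\<^sup>2 * \<beta>\<^sup>2 * D + 6 * E)
    = 168 / 814 * (\<tau> * s * L\<^sup>2 * A) + 6 / 814 * (\<tau> * s * L\<^sup>2 * \<beta>\<^sup>2 * D) + 6 / 814 * (\<tau> * s * E)"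
    by (simp add: algebra_simps)
  have e5: "L\<^sup>2 * (1 - \<beta>) * D = L\<^sup>2 * D - L\<^sup>2 * (\<beta> * D)"
    "\<tau> / 8 * (n - 1) * E = \<tau> / 8 * n * E - 1 / 8 * (\<tau> * E)" by (simp_all add: field_simps)
  show ?thesis
    using P' T0 T1 T2 T3 T4 T5 A1 C1 D1 D2 E1 G1 unfolding e1 e2 e3 e4 e5 by linarith
qed

section \<open>Second moments under the sampling law\<close>

lemma integrable_norm_power2:
  fixes X :: "'s \<Rightarrow> 'v::euclidean_space"
  assumes "X \<in> borel_measurable M" "(\<integral>\<^sup>+s. ennreal ((norm (X s))\<^sup>2) \<partial>M) \<le> ennreal V"
  shows "integrable M (\<lambda>s. (norm (X s))\<^sup>2)"
proof (rule integrableI_bounded)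
  show "(\<lambda>s. (norm (X s))\<^sup>2) \<in> borel_measurable M" using assms(1) by measurable
  show "(\<integral>\<^sup>+s. ennreal (norm ((norm (X s))\<^sup>2)) \<partial>M) < \<infinity>"
    using assms(2) by (simp add: order.strict_trans1[OF _ ennreal_less_top])
qed

lemma integral_norm_power2_le:
  fixes X :: "'s \<Rightarrow> 'v::euclidean_space"
  assumes "X \<in> borel_measurable M" "(\<integral>\<^sup>+s. ennreal ((norm (X s))\<^sup>2) \<partial>M) \<le> ennreal V" "0 \<le> V"
  shows "(\<integral>s. (norm (X s))\<^sup>2 \<partial>M) \<le> V"
  using assms(2,3) nn_integral_eq_integral[OF integrable_norm_power2[OF assms(1,2)]]
  by (simp add: integral_nonneg)

text \<open>Noise enters the energy estimates pointwise through a linear term, which vanishes in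
  expectation, and through its squared norm. Non-negativity of the left-hand side transfers to the
  right-hand side, so that the extended integral may be computed as a Bochner integral.\<close>

lemma (in prob_space) nn_integral_quadratic_noise_le:
  fixes \<nu> :: "'a \<Rightarrow> 'v::euclidean_space"
  assumes \<nu>: "integrable M \<nu>" "(\<integral>s. \<nu> s \<partial>M) = 0" "(\<integral>\<^sup>+s. ennreal ((norm (\<nu> s))\<^sup>2) \<partial>M) \<le> ennreal V"
    and V: "0 \<le> V" and Q: "0 \<le> Q"
    and f: "\<And>s. s \<in> space M \<Longrightarrow> 0 \<le> f s"
      "\<And>s. s \<in> space M \<Longrightarrow> f s \<le> A + Q * (norm (\<nu> s))\<^sup>2 + l \<bullet> \<nu> s"
  shows "(\<integral>\<^sup>+s. ennreal (f s) \<partial>M) \<le> ennreal (A + Q * V)" "0 \<le> A + Q * V"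
proof -
  define R where "R s = A + Q * (norm (\<nu> s))\<^sup>2 + l \<bullet> \<nu> s" for s
  have R0: "0 \<le> R s" if "s \<in> space M" for s
    using f(1)[OF that] f(2)[OF that] unfolding R_def by linarith
  have m: "\<nu> \<in> borel_measurable M" using \<nu>(1) by (rule borel_measurable_integrable)
  have int2: "integrable M (\<lambda>s. (norm (\<nu> s))\<^sup>2)" by (rule integrable_norm_power2[OF m \<nu>(3)])
  have intl: "integrable M (\<lambda>s. l \<bullet> \<nu> s)" using \<nu>(1) by (rule integrable_inner_right)
  have intR: "integrable M R" unfolding R_def using int2 intl by auto
  have "(\<integral>\<^sup>+s. ennreal (f s) \<partial>M) \<le> (\<integral>\<^sup>+s. ennreal (R s) \<partial>M)"
    using f by (intro nn_integral_mono ennreal_leI) (auto simp: R_def)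
  also have "\<dots> = ennreal (\<integral>s. R s \<partial>M)"
    using R0 by (intro nn_integral_eq_integral intR AE_I2)
  finally have le: "(\<integral>\<^sup>+s. ennreal (f s) \<partial>M) \<le> ennreal (\<integral>s. R s \<partial>M)" .
  have "(\<integral>s. R s \<partial>M) = A + Q * (\<integral>s. (norm (\<nu> s))\<^sup>2 \<partial>M) + l \<bullet> (\<integral>s. \<nu> s \<partial>M)"
    unfolding R_def using int2 intl \<nu>(1) by (simp add: prob_space)
  then have R: "(\<integral>s. R s \<partial>M) \<le> A + Q * V"
    using integral_norm_power2_le[OF m \<nu>(3) V] Q \<nu>(2) by (simp add: mult_left_mono)
  show "(\<integral>\<^sup>+s. ennreal (f s) \<partial>M) \<le> ennreal (A + Q * V)"
    using le ennreal_leI[OF R] by (rule order_trans)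
  have "0 \<le> (\<integral>s. R s \<partial>M)"
    using R0 by (intro integral_nonneg_AE AE_I2)
  then show "0 \<le> A + Q * V" using R by linarith
qed

text \<open>Both inequalities express that the second moment is the variance plus the squared norm of the
  mean. The first bounds the noise of oracle differences, the second transfers the Lipschitz constant
  from the oracle to its mean.\<close>

lemma (in prob_space) second_moment_centered:
  fixes X :: "'a \<Rightarrow> 'v::euclidean_space"
  assumes X: "integrable M X" "(\<integral>s. X s \<partial>M) = m" "(\<integral>\<^sup>+s. ennreal ((norm (X s))\<^sup>2) \<partial>M) \<le> ennreal V" "0 \<le> V"
  shows "(\<integral>\<^sup>+s. ennreal ((norm (X s - m))\<^sup>2) \<partial>M) \<le> ennreal V" "(norm m)\<^sup>2 \<le> V"
proof -
  have mX: "X \<in> borel_measurable M" using X(1) by (rule borel_measurable_integrable)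
  have int2: "integrable M (\<lambda>s. (norm (X s))\<^sup>2)" by (rule integrable_norm_power2[OF mX X(3)])
  have intm: "integrable M (\<lambda>s. m \<bullet> X s)" using X(1) by (rule integrable_inner_right)
  have eq: "(norm (X s - m))\<^sup>2 = (norm (X s))\<^sup>2 - 2 * (m \<bullet> X s) + (norm m)\<^sup>2" for s
    unfolding power2_norm_eq_inner by (simp add: inner_diff inner_commute algebra_simps)
  have intc: "integrable M (\<lambda>s. (norm (X s - m))\<^sup>2)" unfolding eq using int2 intm by auto
  have "(\<integral>s. (norm (X s - m))\<^sup>2 \<partial>M) = (\<integral>s. (norm (X s))\<^sup>2 \<partial>M) - 2 * (m \<bullet> m) + (norm m)\<^sup>2"
    unfolding eq using int2 intm X(1,2) by (simp add: prob_space)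
  also have "\<dots> \<le> V - (norm m)\<^sup>2"
    using integral_norm_power2_le[OF mX X(3,4)] by (simp add: power2_norm_eq_inner)
  finally have le: "(\<integral>s. (norm (X s - m))\<^sup>2 \<partial>M) \<le> V - (norm m)\<^sup>2" .
  have "0 \<le> (\<integral>s. (norm (X s - m))\<^sup>2 \<partial>M)" by (intro integral_nonneg_AE) auto
  then show "(norm m)\<^sup>2 \<le> V" using le by linarith
  have "(\<integral>\<^sup>+s. ennreal ((norm (X s - m))\<^sup>2) \<partial>M) = ennreal (\<integral>s. (norm (X s - m))\<^sup>2 \<partial>M)"
    by (intro nn_integral_eq_integral intc) auto
  also have "\<dots> \<le> ennreal V" using le zero_le_power2[of "norm m"] by (intro ennreal_leI) linarith
  finally show "(\<integral>\<^sup>+s. ennreal ((norm (X s - m))\<^sup>2) \<partial>M) \<le> ennreal V" .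
qed

section \<open>Energy decrease in expectation\<close>

text \<open>The saddle structure matters only through a monotone operator and the subdifferential of a convex
  function, so the convergence analysis is carried out for such inclusions.\<close>

locale stochastic_inclusion =
  fixes h :: "'v::euclidean_space \<Rightarrow> ereal" and F :: "'v \<Rightarrow> 'v" and Ft :: "'v \<Rightarrow> 's \<Rightarrow> 'v"
    and \<Xi> :: "'s measure" and L B G :: real and z0 zs :: 'v
  assumes h: "ereal_convex h" "proper_fun h" "lower_semicont h"
    and monotone: "\<And>z z'. 0 \<le> (F z - F z') \<bullet> (z - z')"
    and solution: "- F zs \<in> subdifferential h zs"
    and constants: "0 < B" "0 < L" "0 \<le> G"
    and prob: "prob_space \<Xi>"
    and oracle_measurable: "(\<lambda>(z, s). Ft z s) \<in> borel_measurable (borel \<Otimes>\<^sub>M \<Xi>)"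
    and unbiased: "\<And>z. integrable \<Xi> (Ft z)" "\<And>z. (\<integral>s. Ft z s \<partial>\<Xi>) = F z"
    and variance: "\<And>z. (\<integral>\<^sup>+s. ennreal ((norm (Ft z s - F z))\<^sup>2) \<partial>\<Xi>)
        \<le> ennreal (B\<^sup>2 * (norm (z - z0))\<^sup>2 + G\<^sup>2)"
    and mean_square_lipschitz: "\<And>z z'. (\<integral>\<^sup>+s. ennreal ((norm (Ft z s - Ft z' s))\<^sup>2) \<partial>\<Xi>)
        \<le> ennreal (L\<^sup>2 * (norm (z - z'))\<^sup>2)"
begin

sublocale \<Xi>: prob_space \<Xi> by (rule prob)

abbreviation "\<tau> \<equiv> tau_const L B"

lemma tau: "0 < \<tau>" "\<tau> \<le> 1 / 4" "\<tau> * B\<^sup>2 \<le> L\<^sup>2 / 12"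
proof -
  show "0 < \<tau>" "\<tau> \<le> 1 / 4" using constants by (auto simp: tau_const_def)
  have "\<tau> * B\<^sup>2 \<le> L\<^sup>2 / (12 * B\<^sup>2) * B\<^sup>2"
    by (intro mult_right_mono) (auto simp: tau_const_def)
  then show "\<tau> * B\<^sup>2 \<le> L\<^sup>2 / 12" using constants by simp
qed

lemma gamma_pos: "0 < gamma_par L k" and inverse_gamma_le: "1 / gamma_par L k \<le> 9 * L"
proof -
  have "2 / 3 \<le> 1 - beta_par k" by (simp add: beta_par_def field_simps)
  then have "2 / 3 / (6 * L) \<le> gamma_par L k"
    unfolding gamma_par_def using constants by (intro divide_right_mono) auto
  then have *: "1 / (9 * L) \<le> gamma_par L k" by simp
  then show "0 < gamma_par L k" using constants by (smt (verit) divide_pos_pos)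
  then show "1 / gamma_par L k \<le> 9 * L" using * constants by (simp add: field_simps)
qed

lemma tau_par_pos: "0 < tau_par L B k"
  using tau(1) by (simp add: tau_par_def)

lemma F_lipschitz: "norm (F z - F z') \<le> L * norm (z - z')"
proof -
  have "(norm (F z - F z'))\<^sup>2 \<le> L\<^sup>2 * (norm (z - z'))\<^sup>2"
    by (rule \<Xi>.second_moment_centered[OF _ _ mean_square_lipschitz]) (auto simp: unbiased)
  then have "(norm (F z - F z'))\<^sup>2 \<le> (L * norm (z - z'))\<^sup>2" by (simp add: power_mult_distrib)
  then show ?thesis by (rule power2_le_imp_le) (use constants in auto)
qed

lemma F_continuous: "continuous_on UNIV F"
proof -
  have "L-lipschitz_on UNIV F"
    using F_lipschitz constants by (intro lipschitz_onI) (auto simp: dist_norm)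
  then show ?thesis by (rule lipschitz_on_continuous_on)
qed

text \<open>The deviation of the new estimator is a multiple of the old deviation plus a centred noise,
  which combines fresh noise at the new point with the noise of an oracle difference.\<close>

lemma estimator_noise:
  fixes z z' :: 'v and \<alpha> :: real
  defines "N \<equiv> \<lambda>b. (Ft z' b - F z') - (1 - \<alpha>) *\<^sub>R (Ft z b - F z)"
  shows "integrable \<Xi> N" "(\<integral>b. N b \<partial>\<Xi>) = 0"
    "(\<integral>\<^sup>+b. ennreal ((norm (N b))\<^sup>2) \<partial>\<Xi>)
      \<le> ennreal (2 * \<alpha>\<^sup>2 * (B\<^sup>2 * (norm (z' - z0))\<^sup>2 + G\<^sup>2) + 2 * (1 - \<alpha>)\<^sup>2 * (L\<^sup>2 * (norm (z' - z))\<^sup>2))"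
proof -
  show "integrable \<Xi> N" "(\<integral>b. N b \<partial>\<Xi>) = 0"
    unfolding N_def by (simp_all add: unbiased \<Xi>.prob_space)
  have m[measurable]: "Ft y \<in> borel_measurable \<Xi>" for y using unbiased(1) by auto
  have le: "(norm (N b))\<^sup>2 \<le> 2 * \<alpha>\<^sup>2 * (norm (Ft z' b - F z'))\<^sup>2
    + 2 * (1 - \<alpha>)\<^sup>2 * (norm ((Ft z' b - Ft z b) - (F z' - F z)))\<^sup>2" for b
  proof -
    have eq: "N b = \<alpha> *\<^sub>R (Ft z' b - F z') + (1 - \<alpha>) *\<^sub>R ((Ft z' b - Ft z b) - (F z' - F z))"
      unfolding N_def by (simp add: algebra_simps)
    have "(norm (N b))\<^sup>2 \<le> 2 * (norm (\<alpha> *\<^sub>R (Ft z' b - F z')))\<^sup>2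
        + 2 * (norm ((1 - \<alpha>) *\<^sub>R ((Ft z' b - Ft z b) - (F z' - F z))))\<^sup>2"
      unfolding eq by (rule norm_add_power2_le)
    then show ?thesis by (simp add: power_mult_distrib)
  qed
  have lip: "(\<integral>\<^sup>+b. ennreal ((norm ((Ft z' b - Ft z b) - (F z' - F z)))\<^sup>2) \<partial>\<Xi>)
      \<le> ennreal (L\<^sup>2 * (norm (z' - z))\<^sup>2)"
    by (rule \<Xi>.second_moment_centered[OF _ _ mean_square_lipschitz]) (auto simp: unbiased)
  have "(\<integral>\<^sup>+b. ennreal ((norm (N b))\<^sup>2) \<partial>\<Xi>)
    \<le> (\<integral>\<^sup>+b. ennreal (2 * \<alpha>\<^sup>2) * ennreal ((norm (Ft z' b - F z'))\<^sup>2)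
      + ennreal (2 * (1 - \<alpha>)\<^sup>2) * ennreal ((norm ((Ft z' b - Ft z b) - (F z' - F z)))\<^sup>2) \<partial>\<Xi>)"
    using le by (intro nn_integral_mono) (simp add: ennreal_leI flip: ennreal_mult ennreal_plus)
  also have "\<dots> = ennreal (2 * \<alpha>\<^sup>2) * (\<integral>\<^sup>+b. ennreal ((norm (Ft z' b - F z'))\<^sup>2) \<partial>\<Xi>)
      + ennreal (2 * (1 - \<alpha>)\<^sup>2) * (\<integral>\<^sup>+b. ennreal ((norm ((Ft z' b - Ft z b) - (F z' - F z)))\<^sup>2) \<partial>\<Xi>)"
    by (simp add: nn_integral_add nn_integral_cmult)
  also have "\<dots> \<le> ennreal (2 * \<alpha>\<^sup>2) * ennreal (B\<^sup>2 * (norm (z' - z0))\<^sup>2 + G\<^sup>2)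
      + ennreal (2 * (1 - \<alpha>)\<^sup>2) * ennreal (L\<^sup>2 * (norm (z' - z))\<^sup>2)"
    by (intro add_mono mult_left_mono variance lip) auto
  also have "\<dots> = ennreal (2 * \<alpha>\<^sup>2 * (B\<^sup>2 * (norm (z' - z0))\<^sup>2 + G\<^sup>2) + 2 * (1 - \<alpha>)\<^sup>2 * (L\<^sup>2 * (norm (z' - z))\<^sup>2))"
    by (simp flip: ennreal_mult ennreal_plus)
  finally show "(\<integral>\<^sup>+b. ennreal ((norm (N b))\<^sup>2) \<partial>\<Xi>)
      \<le> ennreal (2 * \<alpha>\<^sup>2 * (B\<^sup>2 * (norm (z' - z0))\<^sup>2 + G\<^sup>2) + 2 * (1 - \<alpha>)\<^sup>2 * (L\<^sup>2 * (norm (z' - z))\<^sup>2))" .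
qed

definition new_point :: "nat \<Rightarrow> 'v \<times> 'v \<Rightarrow> 's \<Rightarrow> 'v" where
  "new_point k x a = prox (\<lambda>w. ereal (tau_par L B k * gamma_par L k) * h w)
     (z_bar z0 k (fst x) - (tau_par L B k * gamma_par L k) *\<^sub>R Ft (half_step h L z0 k (fst x) (snd x)) a)"

definition step :: "nat \<Rightarrow> 'v \<times> 'v \<Rightarrow> 's \<Rightarrow> 's \<Rightarrow> 'v \<times> 'v" where
  "step k x a b = (new_point k x a,
     Ft (new_point k x a) b + (1 - alpha_par k) *\<^sub>R (snd x - Ft (fst x) b))"

text \<open>The factor \<open>k + 2\<close> in front of the squared distance is what the anchor weight \<open>1 / (k + 3)\<close> makes
  telescope. The factor \<open>\<tau> / 8\<close> is large enough for the decay of the estimator error to pay for its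
  influence on the extrapolation, and small enough for the new error, which the displacement of the
  iterate causes, to be paid for by the proximal steps.\<close>

definition energy :: "nat \<Rightarrow> 'v \<times> 'v \<Rightarrow> real" where
  "energy k x = L\<^sup>2 * (real k + 2) * (norm (fst x - zs))\<^sup>2
     + \<tau> / 8 * (real k + 2) * (norm (snd x - F (fst x)))\<^sup>2"

definition residual :: "'v \<Rightarrow> ennreal" where
  "residual z = (dist_set 0 (op_sum F (subdifferential h) z))\<^sup>2"

lemma energy_nonneg: "0 \<le> energy k x"
  unfolding energy_def using tau(1) by simp

lemma z_bar_diff: "z_bar z0 k z - z = beta_par k *\<^sub>R (z0 - z)"
  "z_bar z0 k z - z0 = (1 - beta_par k) *\<^sub>R (z - z0)"
  unfolding z_bar_def by (simp_all add: algebra_simps)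

lemma half_step_subdifferential:
  "(1 / gamma_par L k) *\<^sub>R (z_bar z0 k z - gamma_par L k *\<^sub>R g - half_step h L z0 k z g)
    \<in> subdifferential h (half_step h L z0 k z g)"
  by (rule prox_cmult_subdifferential[OF h gamma_pos]) (simp add: half_step_def)

lemma new_point_subdifferential:
  "(1 / (tau_par L B k * gamma_par L k)) *\<^sub>R (z_bar z0 k (fst x) - (tau_par L B k * gamma_par L k) *\<^sub>R
      Ft (half_step h L z0 k (fst x) (snd x)) a - new_point k x a)
    \<in> subdifferential h (new_point k x a)"
  by (rule prox_cmult_subdifferential[OF h mult_pos_pos[OF tau_par_pos gamma_pos]]) (simp add: new_point_def)

lemma half_step_estimator_error:
  fixes z g :: 'v and k :: nat
  defines "w \<equiv> half_step h L z0 k z g"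
  shows "(norm (F w - g))\<^sup>2 \<le> 3 * L\<^sup>2 * (norm (w - z_bar z0 k z))\<^sup>2
    + 3 * L\<^sup>2 * (beta_par k)\<^sup>2 * (norm (z - z0))\<^sup>2 + 3 * (norm (g - F z))\<^sup>2"
proof -
  have lip: "(norm (F x - F y))\<^sup>2 \<le> L\<^sup>2 * (norm (x - y))\<^sup>2" for x y
    using power_mono[OF F_lipschitz norm_ge_zero, of x y 2] by (simp add: power_mult_distrib)
  have "(norm (F w - g))\<^sup>2 \<le> 3 * (norm (F w - F (z_bar z0 k z)))\<^sup>2 + 3 * (norm (F (z_bar z0 k z) - F z))\<^sup>2
    + 3 * (norm (F z - g))\<^sup>2"
    using norm_add3_power2_le[of "F w - F (z_bar z0 k z)" "F (z_bar z0 k z) - F z" "F z - g"] by simp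
  then show ?thesis
    using lip[of w "z_bar z0 k z"] lip[of "z_bar z0 k z" z]
    by (simp add: z_bar_diff power_mult_distrib norm_minus_commute)
qed

text \<open>The half step provides an explicit element of the operator at its own result. Since
  \<open>1 / \<gamma> \<le> 9 * L\<close>, its displacement contributes \<open>2 * 81 * L\<^sup>2\<close>, to which the Lipschitz bound adds
  \<open>6 * L\<^sup>2\<close>.\<close>

lemma residual_half_step_le:
  fixes z g :: 'v and k :: nat
  defines "w \<equiv> half_step h L z0 k z g"
  shows "residual w \<le> ennreal (168 * L\<^sup>2 * (norm (w - z_bar z0 k z))\<^sup>2
    + 6 * L\<^sup>2 * (beta_par k)\<^sup>2 * (norm (z - z0))\<^sup>2 + 6 * (norm (g - F z))\<^sup>2)"
proof -
  define \<gamma> where "\<gamma> = gamma_par L k"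
  define u where "u = F w + (1 / \<gamma>) *\<^sub>R (z_bar z0 k z - \<gamma> *\<^sub>R g - w)"
  have "u \<in> op_sum F (subdifferential h) w"
    unfolding op_sum_def u_def w_def \<gamma>_def using half_step_subdifferential by blast
  then have "dist_set 0 (op_sum F (subdifferential h) w) \<le> ennreal (norm u)"
    unfolding dist_set_def by (intro INF_lower2[of u]) auto
  then have "residual w \<le> (ennreal (norm u))\<^sup>2" unfolding residual_def by (intro power_mono) auto
  also have "\<dots> = ennreal ((norm u)\<^sup>2)" by (simp add: ennreal_power)
  also have "\<dots> \<le> ennreal (168 * L\<^sup>2 * (norm (w - z_bar z0 k z))\<^sup>2
    + 6 * L\<^sup>2 * (beta_par k)\<^sup>2 * (norm (z - z0))\<^sup>2 + 6 * (norm (g - F z))\<^sup>2)"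
  proof (rule ennreal_leI)
    have "u = (F w - g) + (1 / \<gamma>) *\<^sub>R (z_bar z0 k z - w)"
      unfolding u_def using gamma_pos[of k] by (simp add: \<gamma>_def algebra_simps)
    then have "(norm u)\<^sup>2 \<le> 2 * (norm (F w - g))\<^sup>2 + 2 * ((1 / \<gamma>)\<^sup>2 * (norm (w - z_bar z0 k z))\<^sup>2)"
      using norm_add_power2_le[of "F w - g" "(1 / \<gamma>) *\<^sub>R (z_bar z0 k z - w)"]
      by (simp add: power_mult_distrib power_divide norm_minus_commute)
    moreover have "(1 / \<gamma>)\<^sup>2 * (norm (w - z_bar z0 k z))\<^sup>2 \<le> (9 * L)\<^sup>2 * (norm (w - z_bar z0 k z))\<^sup>2"
      using inverse_gamma_le[of k] gamma_pos[of k] unfolding \<gamma>_def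
      by (intro mult_right_mono power_mono) auto
    ultimately show "(norm u)\<^sup>2 \<le> 168 * L\<^sup>2 * (norm (w - z_bar z0 k z))\<^sup>2
      + 6 * L\<^sup>2 * (beta_par k)\<^sup>2 * (norm (z - z0))\<^sup>2 + 6 * (norm (g - F z))\<^sup>2"
      using half_step_estimator_error[where k = k and z = z and g = g] unfolding w_def[symmetric]
      by (simp add: power_mult_distrib)
  qed
  finally show ?thesis .
qed

text \<open>The three subgradients are those provided by the full step, by the solution and by the half step.\<close>

lemma new_point_distance:
  fixes x k a
  defines "z \<equiv> fst x" and "g \<equiv> snd x" and "t \<equiv> tau_par L B k" and "\<gamma> \<equiv> gamma_par L k"
  defines "w \<equiv> half_step h L z0 k z g" and "zb \<equiv> z_bar z0 k z" and "zp \<equiv> new_point k x a"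
  defines "\<nu> \<equiv> Ft w a - F w"
  shows "(norm (zp - zs))\<^sup>2 \<le> (norm (zb - zs))\<^sup>2 - (3 / 4 - t) * (norm (zp - zb))\<^sup>2
    - t * (norm (w - zb))\<^sup>2 + t * \<gamma>\<^sup>2 * (norm (F w - g))\<^sup>2
    + 4 * (t * \<gamma>)\<^sup>2 * (norm \<nu>)\<^sup>2 - 2 * (t * \<gamma>) * (\<nu> \<bullet> (zb - zs))"
proof (rule two_step_prox_inequality)
  show "0 < t" "0 < \<gamma>" unfolding t_def \<gamma>_def by (rule tau_par_pos gamma_pos)+
  have "Ft w a = F w + \<nu>" by (simp add: \<nu>_def)
  then have "(1 / (t * \<gamma>)) *\<^sub>R (zb - (t * \<gamma>) *\<^sub>R (F w + \<nu>) - zp) \<bullet> (zs - zp) + (- F zs) \<bullet> (w - zs)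
    + (1 / \<gamma>) *\<^sub>R (zb - \<gamma> *\<^sub>R g - w) \<bullet> (zp - w) \<le> 0"
    using subdifferential_cyclically_monotone[OF h(2) new_point_subdifferential[of k x a] solution
        half_step_subdifferential[of k z g]]
    unfolding z_def g_def t_def \<gamma>_def w_def zb_def zp_def by simp
  then show "(1 / (t * \<gamma>)) *\<^sub>R (zb - (t * \<gamma>) *\<^sub>R (F w + \<nu>) - zp) \<bullet> (zs - zp)
    + (1 / \<gamma>) *\<^sub>R (zb - \<gamma> *\<^sub>R g - w) \<bullet> (zp - w) \<le> F w \<bullet> (w - zs)"
    using monotone[of w zs] by (simp add: inner_diff_left)
qed

text \<open>The past is fixed here. The inner integral concerns the sample that updates the estimator, the
  outer one the sample used at the extrapolated point. In both, the noise enters the energy through a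
  linear term and a squared norm, so that only its second moment remains.\<close>

lemma energy_decrease:
  "(\<integral>\<^sup>+a. (\<integral>\<^sup>+b. ennreal (energy (Suc k) (step k x a b)) \<partial>\<Xi>) \<partial>\<Xi>)
     + ennreal (\<tau> / 814 * sqrt (real k + 3)) * residual (half_step h L z0 k (fst x) (snd x))
   \<le> ennreal (energy k x + (L\<^sup>2 * (norm (z0 - zs))\<^sup>2 + (\<tau> + 2)\<^sup>2 * G\<^sup>2))"
proof -
  define n where "n = real k + 3"
  define s where "s = sqrt n"
  define t where "t = tau_par L B k"
  define \<beta> where "\<beta> = beta_par k"
  define \<gamma> where "\<gamma> = gamma_par L k"
  define \<alpha> where "\<alpha> = alpha_par k"
  define z where "z = fst x"
  define g where "g = snd x"
  define w where "w = half_step h L z0 k z g"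
  define zb where "zb = z_bar z0 k z"
  define zp where "zp = new_point k x"
  define \<nu> where "\<nu> a = Ft w a - F w" for a
  define Rw where "Rw = 168 * L\<^sup>2 * (norm (w - zb))\<^sup>2 + 6 * L\<^sup>2 * \<beta>\<^sup>2 * (norm (z - z0))\<^sup>2 + 6 * (norm (g - F z))\<^sup>2"
  define Q where "Q = L\<^sup>2 * n * (4 * (t * \<gamma>)\<^sup>2)"
  define V where "V = B\<^sup>2 * (norm (w - z0))\<^sup>2 + G\<^sup>2"
  define J where "J a = L\<^sup>2 * n * (norm (zp a - zs))\<^sup>2 + \<tau> / 8 * n * ((1 - \<alpha>)\<^sup>2 * (norm (g - F z))\<^sup>2
      + (2 * \<alpha>\<^sup>2 * (B\<^sup>2 * (norm (zp a - z0))\<^sup>2 + G\<^sup>2) + 2 * (1 - \<alpha>)\<^sup>2 * (L\<^sup>2 * (norm (zp a - z))\<^sup>2)))" for a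
  define T where "T = energy k x + (L\<^sup>2 * (norm (z0 - zs))\<^sup>2 + (\<tau> + 2)\<^sup>2 * G\<^sup>2)"
  define r where "r = 1 / 814 * \<tau> * s * Rw"
  have n: "3 \<le> n" by (simp add: n_def)
  have \<beta>01: "0 \<le> \<beta>" "\<beta> \<le> 1" by (auto simp: \<beta>_def beta_par_def)
  have inner: "(\<integral>\<^sup>+b. ennreal (energy (Suc k) (step k x a b)) \<partial>\<Xi>) \<le> ennreal (J a)" for a
  proof -
    define N where "N b = (Ft (zp a) b - F (zp a)) - (1 - \<alpha>) *\<^sub>R (Ft z b - F z)" for b
    note N = estimator_noise[of "zp a" \<alpha> z, folded N_def]
    have "(\<integral>\<^sup>+b. ennreal (energy (Suc k) (step k x a b)) \<partial>\<Xi>)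
      \<le> ennreal ((L\<^sup>2 * n * (norm (zp a - zs))\<^sup>2 + \<tau> / 8 * n * ((1 - \<alpha>)\<^sup>2 * (norm (g - F z))\<^sup>2))
        + \<tau> / 8 * n * (2 * \<alpha>\<^sup>2 * (B\<^sup>2 * (norm (zp a - z0))\<^sup>2 + G\<^sup>2) + 2 * (1 - \<alpha>)\<^sup>2 * (L\<^sup>2 * (norm (zp a - z))\<^sup>2)))"
    proof (rule \<Xi>.nn_integral_quadratic_noise_le(1)[OF N])
      fix b
      have eq: "snd (step k x a b) - F (fst (step k x a b)) = (1 - \<alpha>) *\<^sub>R (g - F z) + N b"
        unfolding step_def N_def \<alpha>_def z_def g_def zp_def by (simp add: algebra_simps)
      have "(norm (snd (step k x a b) - F (fst (step k x a b))))\<^sup>2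
        = (1 - \<alpha>)\<^sup>2 * (norm (g - F z))\<^sup>2 + (norm (N b))\<^sup>2 + 2 * (1 - \<alpha>) * ((g - F z) \<bullet> N b)"
        unfolding eq power2_norm_eq_inner
        by (simp add: inner_add inner_commute power2_eq_square algebra_simps)
      moreover have "fst (step k x a b) = zp a" by (simp add: step_def zp_def)
      moreover have "real (Suc k) + 2 = n" by (simp add: n_def)
      ultimately have "energy (Suc k) (step k x a b) = L\<^sup>2 * n * (norm (zp a - zs))\<^sup>2
          + \<tau> / 8 * n * ((1 - \<alpha>)\<^sup>2 * (norm (g - F z))\<^sup>2 + (norm (N b))\<^sup>2 + 2 * (1 - \<alpha>) * ((g - F z) \<bullet> N b))"
        unfolding energy_def by simp
      then show "energy (Suc k) (step k x a b) \<le> (L\<^sup>2 * n * (norm (zp a - zs))\<^sup>2 + \<tau> / 8 * n * ((1 - \<alpha>)\<^sup>2 * (norm (g - F z))\<^sup>2))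
          + \<tau> / 8 * n * (norm (N b))\<^sup>2 + ((\<tau> / 8 * n * (2 * (1 - \<alpha>))) *\<^sub>R (g - F z)) \<bullet> N b"
        by (simp add: distrib_left)
    qed (use energy_nonneg tau(1) n in auto)
    then show ?thesis unfolding J_def by (simp add: algebra_simps)
  qed
  \<comment> \<open>The variance term \<open>Q * V\<close>, already part of the budget, is subtracted here; integrating the squared
    noise restores it.\<close>
  have J: "J a \<le> (T - r - Q * V) + Q * (norm (\<nu> a))\<^sup>2 + (- (2 * (L\<^sup>2 * n * (t * \<gamma>))) *\<^sub>R (zb - zs)) \<bullet> \<nu> a" for a
  proof -
    have zbs: "(norm (zb - zs))\<^sup>2 = \<beta> * (norm (z0 - zs))\<^sup>2 + (1 - \<beta>) * (norm (z - zs))\<^sup>2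
        - \<beta> * (1 - \<beta>) * (norm (z - z0))\<^sup>2"
      unfolding zb_def z_bar_def \<beta>_def[symmetric] by (rule norm_convex_comb_diff_power2)
    have shrink: "(norm (zb - z0))\<^sup>2 \<le> (norm (z - z0))\<^sup>2"
      unfolding zb_def z_bar_diff \<beta>_def[symmetric] using \<beta>01
      by (auto simp: power_mult_distrib power_le_one intro!: mult_left_le_one_le)
    have Y: "(norm (zp a - z0))\<^sup>2 \<le> 2 * (norm (zp a - zb))\<^sup>2 + 2 * (norm (z - z0))\<^sup>2"
      using norm_add_power2_le[of "zp a - zb" "zb - z0", simplified] shrink by linarith
    have V: "(norm (w - z0))\<^sup>2 \<le> 2 * (norm (w - zb))\<^sup>2 + 2 * (norm (z - z0))\<^sup>2"
      using norm_add_power2_le[of "w - zb" "zb - z0", simplified] shrink by linarith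
    have "(norm (zb - z))\<^sup>2 = \<beta>\<^sup>2 * (norm (z - z0))\<^sup>2"
      unfolding zb_def z_bar_diff \<beta>_def[symmetric] by (simp add: power_mult_distrib norm_minus_commute)
    then have W: "(norm (zp a - z))\<^sup>2 \<le> 2 * (norm (zp a - zb))\<^sup>2 + 2 * \<beta>\<^sup>2 * (norm (z - z0))\<^sup>2"
      using norm_add_power2_le[of "zp a - zb" "zb - z"] by simp
    have P: "(norm (zp a - zs))\<^sup>2 \<le> (norm (zb - zs))\<^sup>2 - (3 / 4 - t) * (norm (zp a - zb))\<^sup>2
        - t * (norm (w - zb))\<^sup>2 + t * \<gamma>\<^sup>2 * (norm (F w - g))\<^sup>2
        + 4 * (t * \<gamma>)\<^sup>2 * (norm (\<nu> a))\<^sup>2 - 2 * (t * \<gamma>) * (\<nu> a \<bullet> (zb - zs))"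
      unfolding z_def g_def t_def \<gamma>_def w_def zb_def zp_def \<nu>_def by (rule new_point_distance)
    have X: "(norm (F w - g))\<^sup>2 \<le> 3 * L\<^sup>2 * (norm (w - zb))\<^sup>2 + 3 * L\<^sup>2 * \<beta>\<^sup>2 * (norm (z - z0))\<^sup>2
        + 3 * (norm (g - F z))\<^sup>2"
      unfolding w_def zb_def \<beta>_def by (rule half_step_estimator_error)
    have eqs: "t = \<tau> / s" "\<beta> = 1 / n" "\<gamma> = (1 - \<beta>) / (6 * L)" "\<alpha> = 2 / s"
      by (simp_all add: t_def s_def n_def \<beta>_def \<gamma>_def \<alpha>_def tau_par_def beta_par_def gamma_par_def alpha_par_def)
    have "energy k x = L\<^sup>2 * (n - 1) * (norm (z - zs))\<^sup>2 + \<tau> / 8 * (n - 1) * (norm (g - F z))\<^sup>2"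
      unfolding energy_def n_def z_def g_def by (simp add: add.commute)
    then show ?thesis
      using step_size_budget[OF n tau constants(2) zero_le_power2 zero_le_power2 zero_le_power2 zero_le_power2
          s_def eqs P[unfolded zbs] X Y W V, of G]
      unfolding J_def T_def Q_def V_def r_def Rw_def by (simp add: inner_commute)
  qed
  have J0: "0 \<le> J a" for a unfolding J_def using n tau(1) by simp
  have Rw0: "0 \<le> Rw" unfolding Rw_def by simp
  have r0: "0 \<le> r" unfolding r_def s_def using n tau(1) Rw0 by simp
  have \<nu>: "integrable \<Xi> \<nu>" "(\<integral>a. \<nu> a \<partial>\<Xi>) = 0" unfolding \<nu>_def by (simp_all add: unbiased \<Xi>.prob_space)
  have v: "(\<integral>\<^sup>+a. ennreal ((norm (\<nu> a))\<^sup>2) \<partial>\<Xi>) \<le> ennreal V" "0 \<le> V" "0 \<le> Q"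
    using variance n by (auto simp: \<nu>_def V_def Q_def)
  note J_le = \<Xi>.nn_integral_quadratic_noise_le[OF \<nu> v J0 J]
  have "(\<integral>\<^sup>+a. (\<integral>\<^sup>+b. ennreal (energy (Suc k) (step k x a b)) \<partial>\<Xi>) \<partial>\<Xi>) \<le> (\<integral>\<^sup>+a. ennreal (J a) \<partial>\<Xi>)"
    by (intro nn_integral_mono inner)
  also have "\<dots> \<le> ennreal (T - r)" using J_le(1) by simp
  finally have outer: "(\<integral>\<^sup>+a. (\<integral>\<^sup>+b. ennreal (energy (Suc k) (step k x a b)) \<partial>\<Xi>) \<partial>\<Xi>) \<le> ennreal (T - r)" .
  have "0 \<le> T - r" using J_le(2) by simp
  have "ennreal (\<tau> / 814 * s) * residual w \<le> ennreal (\<tau> / 814 * s) * ennreal Rw"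
    unfolding Rw_def w_def zb_def \<beta>_def by (intro mult_left_mono residual_half_step_le) auto
  also have "\<dots> = ennreal r"
    unfolding r_def using tau(1) n Rw0 by (simp add: s_def flip: ennreal_mult)
  finally have res: "ennreal (\<tau> / 814 * s) * residual w \<le> ennreal r" .
  have "ennreal (T - r) + ennreal r = ennreal T"
    using \<open>0 \<le> T - r\<close> r0 by (simp flip: ennreal_plus)
  then show ?thesis
    using add_mono[OF outer res] unfolding T_def s_def n_def w_def z_def g_def by simp
qed

end

section \<open>Integration along the sample path\<close>

context stochastic_inclusion
begin

definition state :: "'v \<Rightarrow> (nat \<Rightarrow> 's) \<Rightarrow> nat \<Rightarrow> 'v \<times> 'v" where
  "state g0 s k = (let (z, g, c) = run h Ft L B z0 g0 s k in (z, g))"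

lemma state_0: "state g0 s 0 = (z0, g0)"
  by (simp add: state_def)

lemma state_Suc: "state g0 s (Suc k) = step k (state g0 s k) (s (2 * k + 1)) (s (2 * k + 2))"
  by (simp add: state_def step_def new_point_def query_def Let_def split: prod.split)

lemma z_half_eq: "z_half h Ft L B z0 g0 s k = half_step h L z0 k (fst (state g0 s k)) (snd (state g0 s k))"
  by (simp add: z_half_def state_def split: prod.split)

lemma oracle_calls_eq: "oracle_calls h Ft L B z0 g0 s k = 3 * k"
  by (induction k) (auto simp: oracle_calls_def query_def Let_def split: prod.split)

lemma state_cong:
  assumes "\<And>j. j \<in> {1..2 * k} \<Longrightarrow> s j = s' j"
  shows "state g0 s k = state g0 s' k"
  using assms
proof (induction k)
  case (Suc k)
  then have "state g0 s k = state g0 s' k" by auto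
  then show ?case using Suc.prems[of "2 * k + 1"] Suc.prems[of "2 * k + 2"] by (simp add: state_Suc)
qed (simp add: state_0)

lemma measurable_F [measurable]: "F \<in> borel_measurable borel"
  by (rule borel_measurable_continuous_onI[OF F_continuous])

lemma measurable_oracle:
  assumes "f \<in> borel_measurable N" "g \<in> measurable N \<Xi>"
  shows "(\<lambda>x. Ft (f x) (g x)) \<in> borel_measurable N"
  using measurable_compose[OF measurable_Pair[OF assms] oracle_measurable] by simp

lemma measurable_prox:
  assumes "0 < (c::real)" "f \<in> borel_measurable N"
  shows "(\<lambda>x. prox (\<lambda>w. ereal c * h w) (f x)) \<in> borel_measurable N"
proof -
  have "continuous_on UNIV (prox (\<lambda>w. ereal c * h w))"
    by (intro continuous_on_prox ereal_convex_cmult proper_fun_cmult lower_semicont_cmult h assms(1))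
  then show ?thesis using assms(2) by (rule borel_measurable_continuous_on)
qed

lemma measurable_half_step:
  assumes [measurable]: "f \<in> borel_measurable N" "g \<in> borel_measurable N"
  shows "(\<lambda>x. half_step h L z0 k (f x) (g x)) \<in> borel_measurable N"
  unfolding half_step_def z_bar_def by (intro measurable_prox gamma_pos) measurable

lemma measurable_step:
  assumes [measurable]: "x \<in> measurable N (borel \<Otimes>\<^sub>M borel)" "a \<in> measurable N \<Xi>" "b \<in> measurable N \<Xi>"
  shows "(\<lambda>\<omega>. step k (x \<omega>) (a \<omega>) (b \<omega>)) \<in> measurable N (borel \<Otimes>\<^sub>M borel)"
proof -
  have x[measurable]: "(\<lambda>\<omega>. fst (x \<omega>)) \<in> borel_measurable N" "(\<lambda>\<omega>. snd (x \<omega>)) \<in> borel_measurable N"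
    by measurable
  have [measurable]: "(\<lambda>\<omega>. Ft (half_step h L z0 k (fst (x \<omega>)) (snd (x \<omega>))) (a \<omega>)) \<in> borel_measurable N"
    by (intro measurable_oracle measurable_half_step x assms)
  have p[measurable]: "(\<lambda>\<omega>. new_point k (x \<omega>) (a \<omega>)) \<in> borel_measurable N"
    unfolding new_point_def z_bar_def
    by (intro measurable_prox mult_pos_pos tau_par_pos gamma_pos) measurable
  have [measurable]: "(\<lambda>\<omega>. Ft (new_point k (x \<omega>) (a \<omega>)) (b \<omega>)) \<in> borel_measurable N"
    "(\<lambda>\<omega>. Ft (fst (x \<omega>)) (b \<omega>)) \<in> borel_measurable N"
    by (intro measurable_oracle x p assms)+
  show ?thesis unfolding step_def by measurable
qed

lemma measurable_step_integral:
  assumes "f \<in> borel_measurable (borel \<Otimes>\<^sub>M borel)"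
  shows "(\<lambda>x. \<integral>\<^sup>+a. (\<integral>\<^sup>+b. f (step k x a b) \<partial>\<Xi>) \<partial>\<Xi>) \<in> borel_measurable (borel \<Otimes>\<^sub>M borel)"
proof -
  have "(\<lambda>y. step k (fst (fst y)) (snd (fst y)) (snd y))
      \<in> measurable (((borel \<Otimes>\<^sub>M borel) \<Otimes>\<^sub>M \<Xi>) \<Otimes>\<^sub>M \<Xi>) (borel \<Otimes>\<^sub>M borel)"
    by (intro measurable_step measurable_compose[OF measurable_fst measurable_fst]
        measurable_compose[OF measurable_fst measurable_snd] measurable_snd)
  from measurable_compose[OF this assms]
  have "(\<lambda>y. \<integral>\<^sup>+b. f (step k (fst y) (snd y) b) \<partial>\<Xi>) \<in> borel_measurable ((borel \<Otimes>\<^sub>M borel) \<Otimes>\<^sub>M \<Xi>)"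
    by (intro \<Xi>.borel_measurable_nn_integral) (simp add: case_prod_beta')
  then show ?thesis
    by (intro \<Xi>.borel_measurable_nn_integral) (simp add: case_prod_beta')
qed

lemma measurable_energy: "(\<lambda>x. ennreal (energy k x)) \<in> borel_measurable (borel \<Otimes>\<^sub>M borel)"
  unfolding energy_def by measurable

lemma measurable_residual: "residual \<in> borel_measurable borel"
proof -
  have [measurable]: "(\<lambda>z. dist_set 0 (op_sum F (subdifferential h) z)) \<in> borel_measurable borel"
    by (rule borel_measurable_residual[OF h(2,3) F_continuous])
  show ?thesis unfolding residual_def[abs_def] by measurable
qed

lemma measurable_residual_half_step:
  "(\<lambda>x. residual (half_step h L z0 k (fst x) (snd x))) \<in> borel_measurable (borel \<Otimes>\<^sub>M borel)"
  by (intro measurable_compose[OF measurable_half_step measurable_residual]) measurable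

lemma measurable_state:
  assumes "{1..2 * k} \<subseteq> I"
  shows "(\<lambda>s. state g0 s k) \<in> measurable (\<Pi>\<^sub>M j\<in>I. \<Xi>) (borel \<Otimes>\<^sub>M borel)"
  using assms
proof (induction k)
  case (Suc k)
  have "2 * k + 1 \<in> I" "2 * k + 2 \<in> I" using Suc.prems by auto
  moreover have "{1..2 * k} \<subseteq> I" using Suc.prems by auto
  ultimately show ?case unfolding state_Suc
    using Suc.IH by (intro measurable_step measurable_component_singleton) auto
qed (simp add: state_0)

definition expectation_at :: "'v \<Rightarrow> nat \<Rightarrow> ('v \<times> 'v \<Rightarrow> ennreal) \<Rightarrow> ennreal" where
  "expectation_at g0 k f = (\<integral>\<^sup>+s. f (state g0 s k) \<partial>(\<Pi>\<^sub>M j\<in>{1..2 * k}. \<Xi>))"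

lemma expectation_at_0: "expectation_at g0 0 f = f (z0, g0)"
proof -
  interpret P: prob_space "\<Pi>\<^sub>M j\<in>{1..2 * 0::nat}. \<Xi>" by (intro prob_space_PiM prob)
  show ?thesis unfolding expectation_at_def state_0 using P.emeasure_space_1 by simp
qed

text \<open>The state after \<open>k\<close> iterations depends on the first \<open>2 * k\<close> samples only, so that the two
  samples of the next iteration can be integrated out first.\<close>

lemma expectation_at_Suc:
  assumes f[measurable]: "f \<in> borel_measurable (borel \<Otimes>\<^sub>M borel)"
  shows "expectation_at g0 (Suc k) f
    = expectation_at g0 k (\<lambda>x. \<integral>\<^sup>+a. (\<integral>\<^sup>+b. f (step k x a b) \<partial>\<Xi>) \<partial>\<Xi>)"
proof -
  interpret product_sigma_finite "\<lambda>_::nat. \<Xi>" by standard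
  let ?I = "{1..2 * k}" and ?J = "insert (2 * k + 1) {1..2 * k}"
  have J: "{1..2 * Suc k} = insert (2 * k + 2) ?J" by auto
  have state_upd: "state g0 (s(2 * k + 2 := b)) (Suc k) = step k (state g0 s k) (s (2 * k + 1)) b" for s b
  proof -
    have "state g0 (s(2 * k + 2 := b)) k = state g0 s k" by (rule state_cong) auto
    then show ?thesis unfolding state_Suc by simp
  qed
  have state_upd': "state g0 (s(2 * k + 1 := a)) k = state g0 s k" for s a
    by (rule state_cong) auto
  have m1: "(\<lambda>s. f (state g0 s (Suc k))) \<in> borel_measurable (\<Pi>\<^sub>M j\<in>insert (2 * k + 2) ?J. \<Xi>)"
    by (intro measurable_compose[OF measurable_state f]) auto
  have st[measurable]: "(\<lambda>s. state g0 s k) \<in> measurable (\<Pi>\<^sub>M j\<in>?J. \<Xi>) (borel \<Otimes>\<^sub>M borel)"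
    by (rule measurable_state) auto
  have c[measurable]: "(\<lambda>s. s (2 * k + 1)) \<in> measurable (\<Pi>\<^sub>M j\<in>?J. \<Xi>) \<Xi>"
    by (rule measurable_component_singleton) auto
  have m2: "(\<lambda>s. \<integral>\<^sup>+b. f (step k (state g0 s k) (s (2 * k + 1)) b) \<partial>\<Xi>) \<in> borel_measurable (\<Pi>\<^sub>M j\<in>?J. \<Xi>)"
  proof (rule \<Xi>.borel_measurable_nn_integral)
    have "(\<lambda>x. step k (state g0 (fst x) k) (fst x (2 * k + 1)) (snd x))
        \<in> measurable ((\<Pi>\<^sub>M j\<in>?J. \<Xi>) \<Otimes>\<^sub>M \<Xi>) (borel \<Otimes>\<^sub>M borel)"
      by (intro measurable_step measurable_compose[OF measurable_fst st]
          measurable_compose[OF measurable_fst c] measurable_snd)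
    from measurable_compose[OF this f]
    show "(\<lambda>(s, b). f (step k (state g0 s k) (s (2 * k + 1)) b)) \<in> borel_measurable ((\<Pi>\<^sub>M j\<in>?J. \<Xi>) \<Otimes>\<^sub>M \<Xi>)"
      by (simp add: case_prod_beta')
  qed
  have "expectation_at g0 (Suc k) f
      = (\<integral>\<^sup>+s. (\<integral>\<^sup>+b. f (state g0 (s(2 * k + 2 := b)) (Suc k)) \<partial>\<Xi>) \<partial>(\<Pi>\<^sub>M j\<in>?J. \<Xi>))"
    unfolding expectation_at_def J by (rule product_nn_integral_insert[OF _ _ m1]) auto
  also have "\<dots> = (\<integral>\<^sup>+s. (\<integral>\<^sup>+b. f (step k (state g0 s k) (s (2 * k + 1)) b) \<partial>\<Xi>) \<partial>(\<Pi>\<^sub>M j\<in>?J. \<Xi>))"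
    unfolding state_upd ..
  also have "\<dots> = (\<integral>\<^sup>+s. (\<integral>\<^sup>+a. (\<integral>\<^sup>+b. f (step k (state g0 (s(2 * k + 1 := a)) k) ((s(2 * k + 1 := a)) (2 * k + 1)) b) \<partial>\<Xi>) \<partial>\<Xi>) \<partial>(\<Pi>\<^sub>M j\<in>?I. \<Xi>))"
    by (rule product_nn_integral_insert[OF _ _ m2]) auto
  also have "\<dots> = expectation_at g0 k (\<lambda>x. \<integral>\<^sup>+a. (\<integral>\<^sup>+b. f (step k x a b) \<partial>\<Xi>) \<partial>\<Xi>)"
    unfolding expectation_at_def state_upd' by simp
  finally show ?thesis .
qed

definition expected_residual :: "'v \<Rightarrow> nat \<Rightarrow> ennreal" where
  "expected_residual g0 k = expectation_at g0 k (\<lambda>x. residual (half_step h L z0 k (fst x) (snd x)))"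

lemma expected_energy_decrease:
  "expectation_at g0 (Suc k) (\<lambda>x. ennreal (energy (Suc k) x))
     + ennreal (\<tau> / 814 * sqrt (real k + 3)) * expected_residual g0 k
   \<le> expectation_at g0 k (\<lambda>x. ennreal (energy k x)) + ennreal (L\<^sup>2 * (norm (z0 - zs))\<^sup>2 + (\<tau> + 2)\<^sup>2 * G\<^sup>2)"
proof -
  let ?P = "\<Pi>\<^sub>M j\<in>{1..2 * k}. \<Xi>"
  interpret P: prob_space ?P by (intro prob_space_PiM prob)
  have st: "(\<lambda>s. state g0 s k) \<in> measurable ?P (borel \<Otimes>\<^sub>M borel)" by (rule measurable_state) auto
  define r where "r s = residual (half_step h L z0 k (fst (state g0 s k)) (snd (state g0 s k)))" for s
  define e where "e s = ennreal (energy k (state g0 s k))" for s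
  define e' where "e' s = (\<integral>\<^sup>+a. (\<integral>\<^sup>+b. ennreal (energy (Suc k) (step k (state g0 s k) a b)) \<partial>\<Xi>) \<partial>\<Xi>)" for s
  define C where "C = L\<^sup>2 * (norm (z0 - zs))\<^sup>2 + (\<tau> + 2)\<^sup>2 * G\<^sup>2"
  have C: "0 \<le> C" by (simp add: C_def)
  have e'[measurable]: "e' \<in> borel_measurable ?P"
    unfolding e'_def by (rule measurable_compose[OF st measurable_step_integral[OF measurable_energy]])
  have r[measurable]: "r \<in> borel_measurable ?P"
    unfolding r_def by (rule measurable_compose[OF st measurable_residual_half_step])
  have e[measurable]: "e \<in> borel_measurable ?P"
    unfolding e_def by (rule measurable_compose[OF st measurable_energy])
  have le: "e' s + ennreal (\<tau> / 814 * sqrt (real k + 3)) * r s \<le> e s + ennreal C" for s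
    using energy_decrease[of k "state g0 s k"] energy_nonneg[of k "state g0 s k"] C
    unfolding e'_def r_def e_def C_def by (simp add: ennreal_plus)
  have "(\<integral>\<^sup>+s. e' s \<partial>?P) + ennreal (\<tau> / 814 * sqrt (real k + 3)) * (\<integral>\<^sup>+s. r s \<partial>?P)
      = (\<integral>\<^sup>+s. e' s \<partial>?P) + (\<integral>\<^sup>+s. ennreal (\<tau> / 814 * sqrt (real k + 3)) * r s \<partial>?P)"
    by (simp only: nn_integral_cmult[OF r])
  also have "\<dots> = (\<integral>\<^sup>+s. e' s + ennreal (\<tau> / 814 * sqrt (real k + 3)) * r s \<partial>?P)"
    by (rule nn_integral_add[symmetric, OF e']) measurable
  also have "\<dots> \<le> (\<integral>\<^sup>+s. e s + ennreal C \<partial>?P)" by (intro nn_integral_mono le)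
  also have "\<dots> = (\<integral>\<^sup>+s. e s \<partial>?P) + (\<integral>\<^sup>+s. ennreal C \<partial>?P)"
    by (rule nn_integral_add[OF e]) measurable
  also have "(\<integral>\<^sup>+s. ennreal C \<partial>?P) = ennreal C"
    by (simp only: nn_integral_const P.emeasure_space_1 mult_1_right)
  finally show ?thesis
    unfolding expectation_at_Suc[OF measurable_energy] expected_residual_def
    unfolding expectation_at_def e'_def r_def e_def C_def .
qed

text \<open>Telescoping of the energy. The initial energy contributes \<open>2 * L\<^sup>2\<close> times the squared initial
  distance, and each iteration adds \<open>L\<^sup>2\<close> times it, which gives the factor \<open>K + 2\<close>.\<close>

lemma sum_expected_residual:
  "(\<Sum>k<K. ennreal (\<tau> / 814 * sqrt (real k + 3)) * expected_residual g0 k)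
    \<le> ennreal ((real K + 2) * L\<^sup>2 * (norm (z0 - zs))\<^sup>2 + \<tau> * (norm (g0 - F z0))\<^sup>2
        + real K * (\<tau> + 2)\<^sup>2 * G\<^sup>2)"
proof -
  define C where "C = L\<^sup>2 * (norm (z0 - zs))\<^sup>2 + (\<tau> + 2)\<^sup>2 * G\<^sup>2"
  have C: "0 \<le> C" by (simp add: C_def)
  have "expectation_at g0 K (\<lambda>x. ennreal (energy K x))
      + (\<Sum>k<K. ennreal (\<tau> / 814 * sqrt (real k + 3)) * expected_residual g0 k)
    \<le> ennreal (energy 0 (z0, g0) + real K * C)"
  proof (induction K)
    case 0
    then show ?case by (simp add: expectation_at_0)
  next
    case (Suc K)
    let ?E = "\<lambda>K. expectation_at g0 K (\<lambda>x. ennreal (energy K x))"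
    let ?r = "\<lambda>k. ennreal (\<tau> / 814 * sqrt (real k + 3)) * expected_residual g0 k"
    have "?E (Suc K) + (\<Sum>k<Suc K. ?r k) = (?E (Suc K) + ?r K) + (\<Sum>k<K. ?r k)"
      by (simp add: ac_simps)
    also have "\<dots> \<le> (?E K + ennreal C) + (\<Sum>k<K. ?r k)"
      using expected_energy_decrease[of g0 K] unfolding C_def by (intro add_right_mono)
    also have "\<dots> = (?E K + (\<Sum>k<K. ?r k)) + ennreal C" by (simp add: ac_simps)
    also have "\<dots> \<le> ennreal (energy 0 (z0, g0) + real K * C) + ennreal C"
      by (intro add_right_mono Suc.IH)
    also have "\<dots> = ennreal (energy 0 (z0, g0) + real (Suc K) * C)"
      using C energy_nonneg[of 0 "(z0, g0)"] by (subst ennreal_plus[symmetric]) (auto simp: algebra_simps)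
    finally show ?case .
  qed
  then have "(\<Sum>k<K. ennreal (\<tau> / 814 * sqrt (real k + 3)) * expected_residual g0 k)
      \<le> ennreal (energy 0 (z0, g0) + real K * C)"
    by (rule order_trans[rotated]) simp
  also have "\<dots> \<le> ennreal ((real K + 2) * L\<^sup>2 * (norm (z0 - zs))\<^sup>2 + \<tau> * (norm (g0 - F z0))\<^sup>2
        + real K * (\<tau> + 2)\<^sup>2 * G\<^sup>2)"
  proof (rule ennreal_leI)
    have "0 \<le> \<tau> * (norm (g0 - F z0))\<^sup>2" using tau(1) by simp
    then show "energy 0 (z0, g0) + real K * C \<le> (real K + 2) * L\<^sup>2 * (norm (z0 - zs))\<^sup>2
        + \<tau> * (norm (g0 - F z0))\<^sup>2 + real K * (\<tau> + 2)\<^sup>2 * G\<^sup>2"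
      unfolding energy_def C_def by (simp add: algebra_simps)
  qed
  finally show ?thesis .
qed

end

section \<open>The averaged rate\<close>

lemma powr_three_halves: "0 \<le> x \<Longrightarrow> x powr (3 / 2) = x * sqrt x"
  using powr_add[of x 1 "1 / 2"] by (cases "x = 0") (auto simp: powr_half_sqrt)

text \<open>Comparison of the sum with the integral of the square root; with \<open>p = sqrt x\<close> and
  \<open>q = sqrt (x + 1)\<close> the induction step amounts to \<open>0 \<le> (q - p)\<^sup>2 * (q + 2 * p)\<close>.\<close>

lemma weight_sum_lower_bound: "2 / 3 * ((real K + 2) powr (3 / 2) - 3 powr (3 / 2)) \<le> weight_sum K"
proof (induction K)
  case 0
  have "(2::real) powr (3 / 2) \<le> 3 powr (3 / 2)" by (intro powr_mono2) auto
  then show ?case by (simp add: weight_sum_def)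
next
  case (Suc K)
  define p where "p = sqrt (real K + 2)"
  define q where "q = sqrt (real K + 3)"
  have pq: "p\<^sup>2 = real K + 2" "q\<^sup>2 = real K + 3" "0 \<le> p" "0 \<le> q" by (auto simp: p_def q_def)
  have "0 \<le> (q - p)\<^sup>2 * (q + 2 * p)" using pq by (intro mult_nonneg_nonneg) auto
  also have "\<dots> = 3 * q * (q\<^sup>2 - p\<^sup>2) - 2 * (q\<^sup>2 * q - p\<^sup>2 * p)"
    by (simp add: power2_eq_square algebra_simps)
  finally have "2 / 3 * (q\<^sup>2 * q - p\<^sup>2 * p) \<le> q" using pq by simp
  moreover have "(real (Suc K) + 2) powr (3 / 2) = q\<^sup>2 * q" "(real K + 2) powr (3 / 2) = p\<^sup>2 * p"
    using powr_three_halves[of "real K + 2"] powr_three_halves[of "real K + 3"] pq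
    by (simp_all add: p_def q_def add.commute)
  moreover have "weight_sum (Suc K) = weight_sum K + q" by (simp add: weight_sum_def q_def)
  ultimately show ?case using Suc.IH by (simp add: algebra_simps)
qed

lemma weight_sum_pos: "0 < K \<Longrightarrow> 0 < weight_sum K"
  unfolding weight_sum_def by (intro sum_pos) auto

lemma rate_bound_bigo: "rate_bound L B G D V \<in> O(\<lambda>K. 1 / sqrt (real K))"
proof -
  let ?p = "\<lambda>K::nat. (real K + 2) powr (3 / 2) - 3 powr (3 / 2)"
  define t where "t = tau_const L B"
  have cmult: "(\<lambda>K. c * f K) \<in> O(g)" if "f \<in> O(g)" for c and f g :: "nat \<Rightarrow> real"
    using that by (cases "c = 0") auto
  have "(\<lambda>K. (real K + 2) / ?p K) \<in> O(\<lambda>K. 1 / sqrt (real K))" "(\<lambda>K. 1 / ?p K) \<in> O(\<lambda>K. 1 / sqrt (real K))"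
    "(\<lambda>K. real K / ?p K) \<in> O(\<lambda>K. 1 / sqrt (real K))"
    by real_asymp+
  then have "(\<lambda>K. 1221 / t * L\<^sup>2 * D\<^sup>2 * ((real K + 2) / ?p K) + 1221 / t * t * V\<^sup>2 * (1 / ?p K)
      + 1221 / t * (t + 2)\<^sup>2 * G\<^sup>2 * (real K / ?p K)) \<in> O(\<lambda>K. 1 / sqrt (real K))"
    by (intro sum_in_bigo cmult)
  also have "(\<lambda>K. 1221 / t * L\<^sup>2 * D\<^sup>2 * ((real K + 2) / ?p K) + 1221 / t * t * V\<^sup>2 * (1 / ?p K)
      + 1221 / t * (t + 2)\<^sup>2 * G\<^sup>2 * (real K / ?p K)) = rate_bound L B G D V"
    unfolding rate_bound_def t_def[symmetric]
    by (rule ext) (simp only: divide_inverse inverse_mult_distrib, simp add: algebra_simps)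
  finally show ?thesis .
qed

text \<open>The factor of the rate is \<open>814 * 3 / 2\<close>: the first factor comes from the energy inequality, the
  second from the comparison of the sum of the weights with an integral.\<close>

lemma weighted_avg_le:
  assumes t: "0 < t" and K: "2 \<le> K"
    and sum: "(\<Sum>k<K. ennreal (t / 814 * sqrt (real k + 3)) * e k) \<le> ennreal N" and N: "0 \<le> N"
  shows "weighted_avg e K \<le> ennreal (1221 / (((real K + 2) powr (3 / 2) - 3 powr (3 / 2)) * t) * N)"
proof -
  define p where "p = (real K + 2) powr (3 / 2) - 3 powr (3 / 2)"
  have p: "0 < p" unfolding p_def using K by (simp add: powr_less_mono2)
  have W: "2 / 3 * p \<le> weight_sum K" unfolding p_def by (rule weight_sum_lower_bound)
  have W0: "0 < weight_sum K" using K by (intro weight_sum_pos) auto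
  define S where "S = (\<Sum>k<K. ennreal (sqrt (real k + 3)) * e k)"
  have "(\<Sum>k<K. ennreal (t / 814 * sqrt (real k + 3)) * e k) = ennreal (t / 814) * S"
    unfolding S_def sum_distrib_left using t
    by (intro sum.cong refl, subst ennreal_mult) (auto simp: mult.assoc)
  with sum have "ennreal (814 / t) * (ennreal (t / 814) * S) \<le> ennreal (814 / t) * ennreal N"
    by (intro mult_left_mono) auto
  moreover have "ennreal (814 / t) * (ennreal (t / 814) * S) = S"
    using t by (simp add: mult.assoc[symmetric] flip: ennreal_mult)
  moreover have "ennreal (814 / t) * ennreal N = ennreal (814 / t * N)"
    using t N by (intro ennreal_mult[symmetric]) auto
  ultimately have "S \<le> ennreal (814 / t * N)" by simp
  then have "weighted_avg e K \<le> ennreal (814 / t * N) / ennreal (weight_sum K)"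
    unfolding weighted_avg_def S_def by (intro divide_right_mono_ennreal)
  also have "\<dots> = ennreal (814 / t * N / weight_sum K)"
    using t N W0 by (intro divide_ennreal) auto
  also have "\<dots> \<le> ennreal (1221 / (p * t) * N)"
  proof (rule ennreal_leI)
    have "814 / t * N / weight_sum K \<le> 814 / t * N / (2 / 3 * p)"
      using t N p W W0 by (intro divide_left_mono) auto
    then show "814 / t * N / weight_sum K \<le> 1221 / (p * t) * N" using t p by (simp add: field_simps)
  qed
  finally show ?thesis unfolding p_def .
qed

section \<open>The law of the sample path and the random index\<close>

lemma (in prob_space) distr_iid_path:
  assumes \<xi>: "indep_vars (\<lambda>_. \<Xi>) \<xi> {1..}" "\<And>j. 1 \<le> j \<Longrightarrow> distr M \<Xi> (\<xi> j) = \<Xi>"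
  shows "(\<lambda>\<omega>. \<lambda>j\<in>{1..}. \<xi> j \<omega>) \<in> measurable M (\<Pi>\<^sub>M j\<in>{1::nat..}. \<Xi>)"
    and "distr M (\<Pi>\<^sub>M j\<in>{1::nat..}. \<Xi>) (\<lambda>\<omega>. \<lambda>j\<in>{1..}. \<xi> j \<omega>) = (\<Pi>\<^sub>M j\<in>{1..}. \<Xi>)"
proof -
  have rv: "random_variable \<Xi> (\<xi> j)" if "j \<in> {1..}" for j using \<xi>(1) that unfolding indep_vars_def by blast
  then show "(\<lambda>\<omega>. \<lambda>j\<in>{1..}. \<xi> j \<omega>) \<in> measurable M (\<Pi>\<^sub>M j\<in>{1::nat..}. \<Xi>)"
    by (intro measurable_restrict) auto
  have "distr M (\<Pi>\<^sub>M j\<in>{1::nat..}. \<Xi>) (\<lambda>\<omega>. \<lambda>j\<in>{1..}. \<xi> j \<omega>) = (\<Pi>\<^sub>M j\<in>{1..}. distr M \<Xi> (\<xi> j))"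
    using \<xi>(1) by (subst indep_vars_iff_distr_eq_PiM'[symmetric]) (auto intro: rv)
  also have "\<dots> = (\<Pi>\<^sub>M j\<in>{1..}. \<Xi>)" using \<xi>(2) by (intro PiM_cong) auto
  finally show "distr M (\<Pi>\<^sub>M j\<in>{1::nat..}. \<Xi>) (\<lambda>\<omega>. \<lambda>j\<in>{1..}. \<xi> j \<omega>) = (\<Pi>\<^sub>M j\<in>{1..}. \<Xi>)" .
qed

text \<open>Conditioning on the event does not change the law of \<open>X\<close>: the density of the event pushed forward
  by \<open>X\<close> is a multiple of that law.\<close>

lemma (in prob_space) nn_integral_indep_event:
  assumes indep: "indep_set \<A> (sets (vimage_algebra (space M) X P))"
    and A: "A \<in> \<A>" and X: "X \<in> measurable M P" and f[measurable]: "f \<in> borel_measurable P"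
  shows "(\<integral>\<^sup>+\<omega>. indicator A \<omega> * f (X \<omega>) \<partial>M) = ennreal (prob A) * (\<integral>\<^sup>+\<omega>. f (X \<omega>) \<partial>M)"
proof -
  have AM[measurable]: "A \<in> events" using indep_setD_ev1[OF indep] A by auto
  note X[measurable]
  have eq: "distr (density M (indicator A)) P X = scale_measure (ennreal (prob A)) (distr M P X)"
  proof (rule measure_eqI)
    fix E assume "E \<in> sets (distr (density M (indicator A)) P X)"
    then have E[measurable]: "E \<in> sets P" by simp
    have "X -` E \<inter> space M \<in> sets (vimage_algebra (space M) X P)" using E by (rule in_vimage_algebra)
    then have "prob (A \<inter> (X -` E \<inter> space M)) = prob A * prob (X -` E \<inter> space M)"
      by (rule indep_setD[OF indep A])
    moreover have "emeasure (density M (indicator A)) (X -` E \<inter> space M) = emeasure M (A \<inter> (X -` E \<inter> space M))"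
      by (subst emeasure_density) (auto simp flip: indicator_inter_arith intro: nn_integral_indicator)
    ultimately show "emeasure (distr (density M (indicator A)) P X) E
        = emeasure (scale_measure (ennreal (prob A)) (distr M P X)) E"
      by (simp add: emeasure_distr emeasure_eq_measure ennreal_mult)
  qed simp
  have "(\<integral>\<^sup>+\<omega>. indicator A \<omega> * f (X \<omega>) \<partial>M) = (\<integral>\<^sup>+\<omega>. f (X \<omega>) \<partial>density M (indicator A))"
    by (subst nn_integral_density) auto
  also have "\<dots> = (\<integral>\<^sup>+x. f x \<partial>distr (density M (indicator A)) P X)"
    by (subst nn_integral_distr) auto
  also have "\<dots> = ennreal (prob A) * (\<integral>\<^sup>+\<omega>. f (X \<omega>) \<partial>M)"
    unfolding eq by (simp add: nn_integral_scale_measure nn_integral_distr)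
  finally show ?thesis .
qed

text \<open>The integrand is split over the finitely many values of the index; each event is independent of
  the sample path, and its probability is the weight in the average.\<close>

lemma random_index_expectation:
  assumes M: "prob_space M"
    and \<xi>: "prob_space.indep_vars M (\<lambda>_. \<Xi>) \<xi> {1..}" "\<And>j. 1 \<le> j \<Longrightarrow> distr M \<Xi> (\<xi> j) = \<Xi>"
    and kh: "random_index M \<Xi> \<xi> K kh" and K: "0 < K"
    and R: "\<And>k. R k \<in> borel_measurable (\<Pi>\<^sub>M j\<in>{1..}. \<Xi>)"
  shows "(\<integral>\<^sup>+\<omega>. R (kh \<omega>) (\<lambda>j\<in>{1..}. \<xi> j \<omega>) \<partial>M) = weighted_avg (\<lambda>k. \<integral>\<^sup>+\<omega>. R k (\<lambda>j\<in>{1..}. \<xi> j \<omega>) \<partial>M) K"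
proof -
  interpret prob_space M by (rule M)
  define P where "P = (\<Pi>\<^sub>M j\<in>{1::nat..}. \<Xi>)"
  define X where "X \<omega> = (\<lambda>j\<in>{1..}. \<xi> j \<omega>)" for \<omega>
  have X[measurable]: "X \<in> measurable M P" unfolding X_def P_def by (rule distr_iid_path(1)[OF \<xi>])
  have R'[measurable]: "R k \<in> borel_measurable P" for k using R unfolding P_def .
  define A where "A k = {\<omega> \<in> space M. kh \<omega> = k}" for k
  have indep: "indep_set (sets (vimage_algebra (space M) kh (count_space UNIV))) (sets (vimage_algebra (space M) X P))"
    and kh_less: "\<And>\<omega>. \<omega> \<in> space M \<Longrightarrow> kh \<omega> < K"
    and pA: "\<And>k. k < K \<Longrightarrow> prob (A k) = sqrt (real k + 3) / weight_sum K"
    using kh unfolding random_index_def A_def X_def[abs_def] P_def by auto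
  have A_eq: "A k = kh -` {k} \<inter> space M" for k unfolding A_def by auto
  have A: "A k \<in> sets (vimage_algebra (space M) kh (count_space UNIV))" for k
    unfolding A_eq by (rule in_vimage_algebra) simp
  then have [measurable]: "A k \<in> events" for k using indep_setD_ev1[OF indep] by blast
  have "(\<integral>\<^sup>+\<omega>. R (kh \<omega>) (X \<omega>) \<partial>M) = (\<integral>\<^sup>+\<omega>. (\<Sum>k<K. indicator (A k) \<omega> * R k (X \<omega>)) \<partial>M)"
  proof (rule nn_integral_cong)
    fix \<omega> assume \<omega>: "\<omega> \<in> space M"
    have "(\<Sum>k<K. indicator (A k) \<omega> * R k (X \<omega>)) = (\<Sum>k<K. if k = kh \<omega> then R k (X \<omega>) else 0)"
      using \<omega> by (intro sum.cong) (auto simp: A_def)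
    then show "R (kh \<omega>) (X \<omega>) = (\<Sum>k<K. indicator (A k) \<omega> * R k (X \<omega>))"
      using kh_less[OF \<omega>] by simp
  qed
  also have "\<dots> = (\<Sum>k<K. \<integral>\<^sup>+\<omega>. indicator (A k) \<omega> * R k (X \<omega>) \<partial>M)"
    by (intro nn_integral_sum) measurable
  also have "\<dots> = (\<Sum>k<K. ennreal (sqrt (real k + 3)) * (\<integral>\<^sup>+\<omega>. R k (X \<omega>) \<partial>M) / ennreal (weight_sum K))"
  proof (rule sum.cong)
    fix k assume k: "k \<in> {..<K}"
    have "ennreal (prob (A k)) = ennreal (sqrt (real k + 3)) / ennreal (weight_sum K)"
      using k pA[of k] weight_sum_pos[OF K] by (simp add: divide_ennreal)
    then show "(\<integral>\<^sup>+\<omega>. indicator (A k) \<omega> * R k (X \<omega>) \<partial>M)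
        = ennreal (sqrt (real k + 3)) * (\<integral>\<^sup>+\<omega>. R k (X \<omega>) \<partial>M) / ennreal (weight_sum K)"
      using nn_integral_indep_event[OF indep A X R', of k k]
      by (simp add: ennreal_divide_times ennreal_times_divide)
  qed simp
  also have "\<dots> = weighted_avg (\<lambda>k. \<integral>\<^sup>+\<omega>. R k (X \<omega>) \<partial>M) K"
    unfolding weighted_avg_def by (simp add: divide_ennreal_def sum_distrib_right)
  finally show ?thesis unfolding X_def .
qed

context stochastic_inclusion
begin

definition path_residual :: "'v \<Rightarrow> nat \<Rightarrow> (nat \<Rightarrow> 's) \<Rightarrow> ennreal" where
  "path_residual g0 k s = residual (z_half h Ft L B z0 g0 s k)"

lemma path_residual_cong:
  assumes "\<And>j. j \<in> {1..2 * k} \<Longrightarrow> s j = s' j"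
  shows "path_residual g0 k s = path_residual g0 k s'"
  using state_cong[OF assms] by (simp add: path_residual_def z_half_eq)

lemma measurable_path_residual:
  assumes "{1..2 * k} \<subseteq> I"
  shows "path_residual g0 k \<in> borel_measurable (\<Pi>\<^sub>M j\<in>I. \<Xi>)"
  unfolding path_residual_def[abs_def] z_half_eq
  by (rule measurable_compose[OF measurable_state[OF assms] measurable_residual_half_step])

lemma integral_path_residual:
  assumes M: "prob_space M"
    and \<xi>: "prob_space.indep_vars M (\<lambda>_. \<Xi>) \<xi> {1..}" "\<And>j. 1 \<le> j \<Longrightarrow> distr M \<Xi> (\<xi> j) = \<Xi>"
  shows "(\<integral>\<^sup>+\<omega>. path_residual g0 k (\<lambda>j\<in>{1..}. \<xi> j \<omega>) \<partial>M) = expected_residual g0 k"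
proof -
  interpret M: prob_space M by (rule M)
  interpret product_prob_space "\<lambda>_::nat. \<Xi>" "{1::nat..}" by standard
  let ?P = "\<Pi>\<^sub>M j\<in>{1::nat..}. \<Xi>" and ?Q = "\<Pi>\<^sub>M j\<in>{1..2 * k}. \<Xi>"
  have m: "path_residual g0 k \<in> borel_measurable ?P" "path_residual g0 k \<in> borel_measurable ?Q"
    by (rule measurable_path_residual; auto)+
  have path: "(\<lambda>\<omega>. \<lambda>j\<in>{1..}. \<xi> j \<omega>) \<in> measurable M ?P"
    by (rule M.distr_iid_path(1)[OF \<xi>])
  have law: "distr M ?P (\<lambda>\<omega>. \<lambda>j\<in>{1..}. \<xi> j \<omega>) = ?P"
    by (rule M.distr_iid_path(2)[OF \<xi>])
  have "(\<integral>\<^sup>+\<omega>. path_residual g0 k (\<lambda>j\<in>{1..}. \<xi> j \<omega>) \<partial>M)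
      = (\<integral>\<^sup>+s. path_residual g0 k s \<partial>distr M ?P (\<lambda>\<omega>. \<lambda>j\<in>{1..}. \<xi> j \<omega>))"
    by (subst nn_integral_distr[OF path]) (simp_all only: measurable_distr_eq1 m(1))
  also have "\<dots> = (\<integral>\<^sup>+s. path_residual g0 k (restrict s {1..2 * k}) \<partial>?P)"
    unfolding law by (intro nn_integral_cong path_residual_cong) auto
  also have "\<dots> = (\<integral>\<^sup>+s. path_residual g0 k s \<partial>distr ?P ?Q (\<lambda>s. restrict s {1..2 * k}))"
    by (subst nn_integral_distr[OF measurable_restrict_subset]) (simp_all only: measurable_distr_eq1 m(2), auto)
  also have "distr ?P ?Q (\<lambda>s. restrict s {1..2 * k}) = ?Q"
    by (rule distr_PiM_restrict_finite) auto
  finally show ?thesis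
    unfolding expected_residual_def expectation_at_def path_residual_def z_half_eq .
qed

end

text \<open>An iteration count of order \<open>\<epsilon>\<^sup>-\<^sup>4\<close> suffices to push a bound of order \<open>1 / sqrt K\<close>
  below \<open>\<epsilon>\<^sup>2\<close>.\<close>

lemma iteration_count:
  fixes bnd :: "nat \<Rightarrow> real"
  assumes "bnd \<in> O(\<lambda>K. 1 / sqrt (real K))"
  obtains Keps :: "real \<Rightarrow> nat" where
    "\<And>\<epsilon>. 0 < \<epsilon> \<Longrightarrow> 2 \<le> Keps \<epsilon>" "\<And>\<epsilon>. 0 < \<epsilon> \<Longrightarrow> bnd (Keps \<epsilon>) \<le> \<epsilon>\<^sup>2"
    "(\<lambda>\<epsilon>. real (3 * Keps \<epsilon>)) \<in> O[at_right 0](\<lambda>\<epsilon>. 1 / \<epsilon> ^ 4)"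
proof -
  obtain c where c: "c > 0" "\<forall>\<^sub>F K in sequentially. norm (bnd K) \<le> c * norm (1 / sqrt (real K))"
    using assms by (elim landau_o.bigE)
  then obtain K0 where K0: "\<And>K. K0 \<le> K \<Longrightarrow> \<bar>bnd K\<bar> \<le> c / sqrt (real K)"
    unfolding eventually_sequentially by auto
  define Keps where "Keps \<epsilon> = K0 + 2 + nat \<lceil>c\<^sup>2 / \<epsilon> ^ 4\<rceil>" for \<epsilon> :: real
  have ge2: "2 \<le> Keps \<epsilon>" for \<epsilon> by (simp add: Keps_def)
  have "bnd (Keps \<epsilon>) \<le> \<epsilon>\<^sup>2" if \<epsilon>: "0 < \<epsilon>" for \<epsilon>
  proof -
    have "(c / \<epsilon>\<^sup>2)\<^sup>2 = c\<^sup>2 / \<epsilon> ^ 4" by (simp add: power_divide flip: power_mult)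
    also have "\<dots> \<le> real (nat \<lceil>c\<^sup>2 / \<epsilon> ^ 4\<rceil>)" by (rule real_nat_ceiling_ge)
    also have "\<dots> \<le> real (Keps \<epsilon>)" by (simp add: Keps_def)
    finally have "c / \<epsilon>\<^sup>2 \<le> sqrt (real (Keps \<epsilon>))" by (rule real_le_rsqrt)
    moreover have "0 < sqrt (real (Keps \<epsilon>))" using ge2[of \<epsilon>] by simp
    ultimately have "c / sqrt (real (Keps \<epsilon>)) \<le> \<epsilon>\<^sup>2" using \<epsilon> by (simp add: field_simps)
    moreover have "\<bar>bnd (Keps \<epsilon>)\<bar> \<le> c / sqrt (real (Keps \<epsilon>))" by (rule K0) (simp add: Keps_def)
    ultimately show ?thesis by linarith
  qed
  moreover have "(\<lambda>\<epsilon>. real (3 * Keps \<epsilon>)) \<in> O[at_right 0](\<lambda>\<epsilon>. 1 / \<epsilon> ^ 4)"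
  proof (rule landau_o.bigI[of "3 * (real K0 + 3 + c\<^sup>2)"])
    show "\<forall>\<^sub>F \<epsilon> in at_right 0. norm (real (3 * Keps \<epsilon>)) \<le> 3 * (real K0 + 3 + c\<^sup>2) * norm (1 / \<epsilon> ^ 4)"
      unfolding eventually_at_right_field
    proof (intro exI[of _ 1] conjI allI impI)
      fix \<epsilon> :: real assume \<epsilon>: "0 < \<epsilon>" "\<epsilon> < 1"
      have one: "1 \<le> 1 / \<epsilon> ^ 4" using \<epsilon> by (simp add: power_le_one)
      have "0 \<le> c\<^sup>2 / \<epsilon> ^ 4" using \<epsilon> by simp
      then have "0 \<le> \<lceil>c\<^sup>2 / \<epsilon> ^ 4\<rceil>" by (metis ceiling_mono ceiling_zero)
      then have "real (nat \<lceil>c\<^sup>2 / \<epsilon> ^ 4\<rceil>) = real_of_int \<lceil>c\<^sup>2 / \<epsilon> ^ 4\<rceil>" by (rule of_nat_nat)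
      also have "\<dots> \<le> c\<^sup>2 / \<epsilon> ^ 4 + 1" by (rule of_int_ceiling_le_add_one)
      finally have "real (nat \<lceil>c\<^sup>2 / \<epsilon> ^ 4\<rceil>) \<le> c\<^sup>2 / \<epsilon> ^ 4 + 1" .
      moreover have "real (Keps \<epsilon>) = real K0 + 2 + real (nat \<lceil>c\<^sup>2 / \<epsilon> ^ 4\<rceil>)"
        by (simp only: Keps_def of_nat_add of_nat_numeral)
      ultimately have "real (Keps \<epsilon>) \<le> (real K0 + 3) * 1 + c\<^sup>2 * (1 / \<epsilon> ^ 4)"
        unfolding mult_1_right times_divide_eq_right by linarith
      also have "\<dots> \<le> (real K0 + 3) * (1 / \<epsilon> ^ 4) + c\<^sup>2 * (1 / \<epsilon> ^ 4)"
        using one by (intro add_mono mult_left_mono) auto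
      finally have "real (Keps \<epsilon>) \<le> (real K0 + 3 + c\<^sup>2) * (1 / \<epsilon> ^ 4)" by (simp only: distrib_right)
      then have "3 * real (Keps \<epsilon>) \<le> 3 * (real K0 + 3 + c\<^sup>2) * (1 / \<epsilon> ^ 4)"
        unfolding mult.assoc by (intro mult_left_mono) auto
      moreover have "norm (real (3 * Keps \<epsilon>)) = 3 * real (Keps \<epsilon>)" by simp
      moreover have "norm (1 / \<epsilon> ^ 4) = 1 / \<epsilon> ^ 4" using \<epsilon> by simp
      ultimately show "norm (real (3 * Keps \<epsilon>)) \<le> 3 * (real K0 + 3 + c\<^sup>2) * norm (1 / \<epsilon> ^ 4)"
        by (simp only:)
    qed simp
  qed (use c in \<open>simp add: add_pos_nonneg\<close>)
  ultimately show ?thesis using that[of Keps] ge2 by blast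
qed

section \<open>The convergence theorem\<close>

theorem theorem4p6:
  fixes \<Psi> :: "(real ^ 'd) \<times> (real ^ 'n) \<Rightarrow> real"
    and h1 :: "real ^ 'd \<Rightarrow> ereal"
    and h2 :: "real ^ 'n \<Rightarrow> ereal"
    and zstar z0 g0 :: "(real ^ 'd) \<times> (real ^ 'n)"
    and Ft :: "(real ^ 'd) \<times> (real ^ 'n) \<Rightarrow> 's \<Rightarrow> (real ^ 'd) \<times> (real ^ 'n)"
    and \<Xi> :: "'s measure"
    and M :: "'w measure"
    and \<xi> :: "nat \<Rightarrow> 'w \<Rightarrow> 's"
    and B L G :: real
  defines "F \<equiv> saddle_F \<Psi>"
    and "H \<equiv> saddle_H h1 h2"
    and "h \<equiv> sep_sum h1 h2"
  defines "zh \<equiv> (\<lambda>k \<omega>. z_half h Ft L B z0 g0 (\<lambda>j. \<xi> j \<omega>) k)"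
  defines "res \<equiv> (\<lambda>k \<omega>. (dist_set 0 (op_sum F H (zh k \<omega>)))\<^sup>2)"
  defines "bound \<equiv> rate_bound L B G (norm (z0 - zstar)) (norm (g0 - F z0))"
  assumes convex_x: "\<And>y. convex_on UNIV (\<lambda>x. \<Psi> (x, y))"
    and concave_y: "\<And>x. concave_on UNIV (\<lambda>y. \<Psi> (x, y))"
    and differentiable: "\<And>z. \<Psi> differentiable (at z)"
    and lipschitz_gradient: "\<exists>C. C-lipschitz_on UNIV (gradient \<Psi>)"
    and h1: "ereal_convex h1" "proper_fun h1" "lower_semicont h1"
    and h2: "ereal_convex h2" "proper_fun h2" "lower_semicont h2"
    and solution: "0 \<in> op_sum F H zstar"
    and constants: "0 < B" "0 < L" "0 \<le> G"
    and prob_spaces: "prob_space \<Xi>" "prob_space M"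
    and oracle_measurable: "(\<lambda>(z, s). Ft z s) \<in> borel_measurable (borel \<Otimes>\<^sub>M \<Xi>)"
    and unbiased: "\<And>z. integrable \<Xi> (Ft z)" "\<And>z. (\<integral>s. Ft z s \<partial>\<Xi>) = F z"
    and variance: "\<And>z. (\<integral>\<^sup>+s. ennreal ((norm (Ft z s - F z))\<^sup>2) \<partial>\<Xi>)
                         \<le> ennreal (B\<^sup>2 * (norm (z - z0))\<^sup>2 + G\<^sup>2)"
    and mean_square_lipschitz:
          "\<And>z z'. (\<integral>\<^sup>+s. ennreal ((norm (Ft z s - Ft z' s))\<^sup>2) \<partial>\<Xi>)
                         \<le> ennreal (L\<^sup>2 * (norm (z - z'))\<^sup>2)"
    and samples_indep: "prob_space.indep_vars M (\<lambda>_. \<Xi>) \<xi> {1..}"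
    and samples_law: "\<And>j. 1 \<le> j \<Longrightarrow> distr M \<Xi> (\<xi> j) = \<Xi>"
  shows "(\<forall>k. res k \<in> borel_measurable M)
    \<and> (\<forall>K\<ge>2. weighted_avg (\<lambda>k. \<integral>\<^sup>+\<omega>. res k \<omega> \<partial>M) K \<le> ennreal (bound K))
    \<and> bound \<in> O(\<lambda>K. 1 / sqrt (real K))
    \<and> (\<forall>K\<ge>2. \<forall>kh. random_index M \<Xi> \<xi> K kh \<longrightarrow>
           (\<integral>\<^sup>+\<omega>. res (kh \<omega>) \<omega> \<partial>M) = weighted_avg (\<lambda>k. \<integral>\<^sup>+\<omega>. res k \<omega> \<partial>M) K)
    \<and> (\<exists>(Keps :: real \<Rightarrow> nat) (N :: real \<Rightarrow> nat).
           (\<forall>\<epsilon>>0. 2 \<le> Keps \<epsilon> \<and>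
              weighted_avg (\<lambda>k. \<integral>\<^sup>+\<omega>. res k \<omega> \<partial>M) (Keps \<epsilon>) \<le> ennreal (\<epsilon>\<^sup>2) \<and>
              (\<forall>kh. random_index M \<Xi> \<xi> (Keps \<epsilon>) kh \<longrightarrow>
                 (\<integral>\<^sup>+\<omega>. res (kh \<omega>) \<omega> \<partial>M) \<le> ennreal (\<epsilon>\<^sup>2)) \<and>
              (\<forall>\<omega>\<in>space M.
                 oracle_calls h Ft L B z0 g0 (\<lambda>j. \<xi> j \<omega>) (Keps \<epsilon>) = N \<epsilon>)) \<and>
           (\<lambda>\<epsilon>. real (N \<epsilon>)) \<in> O[at_right 0](\<lambda>\<epsilon>. 1 / \<epsilon> ^ 4))"
proof -
  have sol: "- F zstar \<in> subdifferential h zstar"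
  proof -
    obtain u where u: "u \<in> H zstar" "0 = F zstar + u"
      using solution unfolding op_sum_def by blast
    then have "u = - F zstar" by (simp add: eq_neg_iff_add_eq_0 add.commute)
    then show ?thesis using u(1) saddle_H_eq_subdifferential[OF h1(2) h2(2)] by (simp add: H_def h_def)
  qed
  interpret stochastic_inclusion h F Ft \<Xi> L B G z0 zstar
  proof (rule stochastic_inclusion.intro)
    show "ereal_convex h" "proper_fun h" "lower_semicont h"
      unfolding h_def by (intro sep_sum_convex sep_sum_proper sep_sum_lower_semicont h1 h2)+
    show "0 \<le> (F z - F z') \<bullet> (z - z')" for z z'
      unfolding F_def by (rule saddle_F_monotone[OF convex_x concave_y differentiable])
  qed (fact sol constants prob_spaces(1) oracle_measurable unbiased variance mean_square_lipschitz)+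
  define path where "path \<omega> = (\<lambda>j\<in>{1..}. \<xi> j \<omega>)" for \<omega>
  have path: "path \<in> measurable M (\<Pi>\<^sub>M j\<in>{1..}. \<Xi>)"
    unfolding path_def[abs_def] by (rule prob_space.distr_iid_path(1)[OF prob_spaces(2) samples_indep samples_law])
  have res: "res k \<omega> = path_residual g0 k (path \<omega>)" for k \<omega>
  proof -
    have H: "H = subdifferential h"
      unfolding H_def h_def by (rule saddle_H_eq_subdifferential[OF h1(2) h2(2)])
    have "res k \<omega> = path_residual g0 k (\<lambda>j. \<xi> j \<omega>)"
      unfolding res_def zh_def path_residual_def residual_def H by (rule refl)
    also have "\<dots> = path_residual g0 k (path \<omega>)" by (rule path_residual_cong) (simp add: path_def)
    finally show ?thesis .
  qed
  have res_eq: "res k = (\<lambda>\<omega>. path_residual g0 k (path \<omega>))" for k using res by (rule ext)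
  have measurable_R: "path_residual g0 k \<in> borel_measurable (\<Pi>\<^sub>M j\<in>{1..}. \<Xi>)" for k
    by (rule measurable_path_residual) auto
  have expected: "(\<integral>\<^sup>+\<omega>. res k \<omega> \<partial>M) = expected_residual g0 k" for k
    unfolding res path_def by (rule integral_path_residual[OF prob_spaces(2) samples_indep samples_law])
  have rate: "weighted_avg (\<lambda>k. \<integral>\<^sup>+\<omega>. res k \<omega> \<partial>M) K \<le> ennreal (bound K)" if "2 \<le> K" for K
    unfolding expected bound_def rate_bound_def
    using tau(1) by (intro weighted_avg_le[OF tau(1) that sum_expected_residual]) auto
  have bigo: "bound \<in> O(\<lambda>K. 1 / sqrt (real K))" unfolding bound_def by (rule rate_bound_bigo)
  have random: "(\<integral>\<^sup>+\<omega>. res (kh \<omega>) \<omega> \<partial>M) = weighted_avg (\<lambda>k. \<integral>\<^sup>+\<omega>. res k \<omega> \<partial>M) K"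
    if "2 \<le> K" "random_index M \<Xi> \<xi> K kh" for K kh
    unfolding res path_def
    using that by (intro random_index_expectation[OF prob_spaces(2) samples_indep samples_law _ _ measurable_R]) auto
  obtain Keps :: "real \<Rightarrow> nat" where Keps: "\<And>\<epsilon>. 0 < \<epsilon> \<Longrightarrow> 2 \<le> Keps \<epsilon>"
    "\<And>\<epsilon>. 0 < \<epsilon> \<Longrightarrow> bound (Keps \<epsilon>) \<le> \<epsilon>\<^sup>2"
    "(\<lambda>\<epsilon>. real (3 * Keps \<epsilon>)) \<in> O[at_right 0](\<lambda>\<epsilon>. 1 / \<epsilon> ^ 4)"
    using iteration_count[OF bigo] by metis
  have eps: "weighted_avg (\<lambda>k. \<integral>\<^sup>+\<omega>. res k \<omega> \<partial>M) (Keps \<epsilon>) \<le> ennreal (\<epsilon>\<^sup>2)" if "0 < \<epsilon>" for \<epsilon>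
    using rate[OF Keps(1)[OF that]] ennreal_leI[OF Keps(2)[OF that]] by (rule order_trans)
  have "\<exists>(Keps :: real \<Rightarrow> nat) (N :: real \<Rightarrow> nat).
           (\<forall>\<epsilon>>0. 2 \<le> Keps \<epsilon> \<and>
              weighted_avg (\<lambda>k. \<integral>\<^sup>+\<omega>. res k \<omega> \<partial>M) (Keps \<epsilon>) \<le> ennreal (\<epsilon>\<^sup>2) \<and>
              (\<forall>kh. random_index M \<Xi> \<xi> (Keps \<epsilon>) kh \<longrightarrow>
                 (\<integral>\<^sup>+\<omega>. res (kh \<omega>) \<omega> \<partial>M) \<le> ennreal (\<epsilon>\<^sup>2)) \<and>
              (\<forall>\<omega>\<in>space M.
                 oracle_calls h Ft L B z0 g0 (\<lambda>j. \<xi> j \<omega>) (Keps \<epsilon>) = N \<epsilon>)) \<and>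
           (\<lambda>\<epsilon>. real (N \<epsilon>)) \<in> O[at_right 0](\<lambda>\<epsilon>. 1 / \<epsilon> ^ 4)"
  proof (rule exI[of _ Keps], rule exI[of _ "\<lambda>\<epsilon>. 3 * Keps \<epsilon>"], intro conjI allI impI ballI)
    show "(\<integral>\<^sup>+\<omega>. res (kh \<omega>) \<omega> \<partial>M) \<le> ennreal (\<epsilon>\<^sup>2)"
      if "0 < \<epsilon>" "random_index M \<Xi> \<xi> (Keps \<epsilon>) kh" for \<epsilon> kh
      using random[OF Keps(1)[OF that(1)] that(2)] eps[OF that(1)] by simp
    show "oracle_calls h Ft L B z0 g0 (\<lambda>j. \<xi> j \<omega>) (Keps \<epsilon>) = 3 * Keps \<epsilon>" for \<epsilon> \<omega>
      by (rule oracle_calls_eq)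
  qed (fact Keps eps)+
  moreover have "res k \<in> borel_measurable M" for k
    unfolding res_eq by (rule measurable_compose[OF path measurable_R])
  ultimately show ?thesis using rate bigo random by blast
qed

end
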